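(* Let $\{Y_n\}_{n\ge 0}$ be a positive Harris and aperiodic Markov chain taking values in a measurable space $(\mathbb{S},\mathcal{S})$, with stationary distribution $\pi$. Let $f:(\mathbb{S},\mathcal{S})\to(\mathbb{R}^1,\mathcal{B}^1)$ be a measurable function, and define $$X_n=f(Y_n),\quad n=0,1,2,\ldots,\qquad M_n=\max_{0\le j\le n-1}X_j,\quad n=1,2,\ldots.$$ (1) If $\{X_n\}$ admits a continuous phantom distribution function $G$ under some initial distribution $\lambda$ (a probability measure on $(\mathbb{S},\mathcal{S})$), i.e. if $G$ is a continuous distribution function on $\mathbb{R}^1$ with $$\sup_{x\in\mathbb{R}^1}\big|\mathbb{P}_{\lambda}(M_n\le x)-G^n(x)\big|\to 0\quad\text{as } n\to\infty, \qquad ( * )$$ then $G$ is also a continuous phantom distribution function for the stationary sequence $\{X_n\}$ under $\pi$, i.e. $\sup_{x\in\mathbb{R}^1}|\mathbb{P}_{\pi}(M_n\le x)-G^n(x)|\to 0$ as $n\to\infty$. (2) Conversely, if $\{X_n\}$ admits a continuous phantom distribution function $G$ under $\pi$, i.e. $G$ is a continuous distribution function with $\sup_{x\in\mathbb{R}^1}|\mathbb{P}_{\pi}(M_n\le x)-G^n(x)|\to 0$, then there exists a set $\mathbb{S}_0\in\mathcal{S}$ satisfying $\pi(\mathbb{S}_0)=0$ and such that relation $( * )$ holds for every initial distribution $\lambda$ with the property that $\lambda(\mathbb{S}_0)=0$.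
   Context: $\{Y_n\}$ is a time-homogeneous Markov chain on a general state space; the terminology is that of Meyn and Tweedie, "Markov Chains and Stochastic Stability". The chain is Harris recurrent if there is a nontrivial $\sigma$-finite measure $\varphi$ on $(\mathbb{S},\mathcal{S})$ such that for every $A\in\mathcal{S}$ with $\varphi(A)>0$ and every starting point $s\in\mathbb{S}$, the chain started at $s$ visits $A$ infinitely often with probability one. It is positive Harris if it is Harris recurrent and admits an invariant probability measure $\pi$ (which is then unique and is called the stationary distribution). It is aperiodic if its period equals one, i.e. there is no cyclic decomposition of $\mathbb{S}$, up to a $\pi$-null set, into $d\ge 2$ disjoint sets $D_0,\dots,D_{d-1}\in\mathcal{S}$ with one-step transition probability $1$ from each point of $D_i$ into $D_{i+1 \bmod d}$. $\mathcal{B}^1$ denotes the Borel $\sigma$-field of $\mathbb{R}^1=\mathbb{R}$. $\mathbb{P}_{\lambda}$ denotes the law of the chain when $Y_0$ has distribution $\lambda$; $\mathbb{P}_{\pi}$ is the case $\lambda=\pi$. A (not necessarily stationary) sequence $\{X_n\}$ with partial maxima $M_n=\max_{0\le j\le n-1}X_j$ admits a phantom distribution function $G$ (a probability distribution function on $\mathbb{R}$) if $\sup_{x\in\mathbb{R}}|\mathbb{P}(M_n\le x)-G^n(x)|\to0$ as $n\to\infty$, where $G^n(x)=(G(x))^n$. *)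

theory Defs
  imports "HOL-Probability.Probability"
begin

section \<open>Markov chains on a general state space\<close>

text \<open>
  A transition kernel on a measurable space \<open>S\<close> is a measurable map
  \<open>K \<in> S \<rightarrow>\<^sub>M prob_algebra S\<close>; the law of the chain started from \<open>lam\<close> is the measure on the
  path space \<open>PiM UNIV (\<lambda>_. S)\<close> given by the Ionescu-Tulcea theorem, so \<open>Y\<^sub>n\<close> is the
  \<open>n\<close>-th coordinate.
\<close>

definition chain_step :: "('a \<Rightarrow> 'a measure) \<Rightarrow> 'a measure \<Rightarrow> nat \<Rightarrow> (nat \<Rightarrow> 'a) \<Rightarrow> 'a measure"
  where "chain_step K lam n \<omega> = (case n of 0 \<Rightarrow> lam | Suc m \<Rightarrow> K (\<omega> m))"

definition chain_law :: "'a measure \<Rightarrow> ('a \<Rightarrow> 'a measure) \<Rightarrow> 'a measure \<Rightarrow> (nat \<Rightarrow> 'a) measure"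
  where "chain_law S K lam =
    projective_family.lim UNIV (Ionescu_Tulcea.CI (chain_step K lam) (\<lambda>_. S)) (\<lambda>_. S)"

lemma Ionescu_Tulcea_chain_step:
  assumes K[measurable]: "K \<in> S \<rightarrow>\<^sub>M prob_algebra S" and lam: "lam \<in> space (prob_algebra S)"
  shows "Ionescu_Tulcea (chain_step K lam) (\<lambda>_. S)"
proof (rule Ionescu_Tulcea.intro)
  fix i :: nat
  show "chain_step K lam i \<in> PiM {0..<i} (\<lambda>_. S) \<rightarrow>\<^sub>M subprob_algebra S"
  proof (cases i)
    case 0
    have "lam \<in> space (subprob_algebra S)"
      using lam by (auto simp: space_prob_algebra space_subprob_algebra prob_space_imp_subprob_space)
    then have "(\<lambda>\<omega>. lam) \<in> PiM {0..<i} (\<lambda>_. S) \<rightarrow>\<^sub>M subprob_algebra S" by simp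
    then show ?thesis by (simp add: 0 chain_step_def[abs_def])
  next
    case (Suc m)
    have "(\<lambda>\<omega>. \<omega> m) \<in> PiM {0..<i} (\<lambda>_. S) \<rightarrow>\<^sub>M S"
      by (rule measurable_component_singleton) (simp add: Suc)
    from measurable_compose[OF this measurable_prob_algebraD[OF K]]
    show ?thesis by (simp add: Suc chain_step_def[abs_def])
  qed
next
  fix i :: nat and x :: "nat \<Rightarrow> 'a"
  assume x: "x \<in> space (PiM {0..<i} (\<lambda>_. S))"
  show "prob_space (chain_step K lam i x)"
  proof (cases i)
    case 0
    then show ?thesis using lam by (simp add: chain_step_def space_prob_algebra)
  next
    case (Suc m)
    have "x m \<in> space S" using x by (auto simp: Suc space_PiM PiE_iff)
    from measurable_space[OF K this] show ?thesis
      by (simp add: Suc chain_step_def space_prob_algebra)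
  qed
qed

lemma sets_chain_law:
  assumes "K \<in> S \<rightarrow>\<^sub>M prob_algebra S" "lam \<in> space (prob_algebra S)"
  shows "sets (chain_law S K lam) = sets (PiM UNIV (\<lambda>_. S))"
proof -
  interpret Ionescu_Tulcea "chain_step K lam" "\<lambda>_. S"
    using assms by (rule Ionescu_Tulcea_chain_step)
  show ?thesis by (simp add: chain_law_def)
qed

lemma prob_space_chain_law:
  assumes "K \<in> S \<rightarrow>\<^sub>M prob_algebra S" "lam \<in> space (prob_algebra S)"
  shows "prob_space (chain_law S K lam)"
proof -
  interpret Ionescu_Tulcea "chain_step K lam" "\<lambda>_. S"
    using assms by (rule Ionescu_Tulcea_chain_step)
  have "PF.emb UNIV {} (space (PiM {} (\<lambda>_. S))) = space PF.lim"
    by (auto simp: prod_emb_def space_PiM PiE_iff restrict_def)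
  then have "emeasure PF.lim (space PF.lim) = emeasure (CI {}) (space (PiM {} (\<lambda>_. S)))"
    using lim[of "{}" "space (PiM {} (\<lambda>_. S))"] by simp
  also have "\<dots> = 1"
    using prob_space.emeasure_space_1[OF PF.prob_space_P[of "{}"]] by (simp add: PF.space_P)
  finally show ?thesis by (simp add: chain_law_def prob_spaceI)
qed

lemma distr_restrict_chain_law:
  assumes "K \<in> S \<rightarrow>\<^sub>M prob_algebra S" "lam \<in> space (prob_algebra S)"
  shows "distr (chain_law S K lam) (PiM {0..<n} (\<lambda>_. S)) (\<lambda>\<omega>. restrict \<omega> {0..<n})
    = Ionescu_Tulcea.C (chain_step K lam) (\<lambda>_. S) 0 n (\<lambda>_. undefined)"
proof -
  interpret Ionescu_Tulcea "chain_step K lam" "\<lambda>_. S"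
    using assms by (rule Ionescu_Tulcea_chain_step)
  have up: "up_to {0..<n} \<le> n" by (simp add: up_to_iff)
  have up': "n \<le> up_to {0..<n}" using up_to_less[of "{0..<n}" "n - 1"] by (cases n) auto
  show ?thesis
    using distr_lim[of "{0..<n}"] distr_C[of n n "\<lambda>_. undefined" 0] up up'
    by (simp add: chain_law_def CI_def)
qed

text \<open>The two properties that determine the law: initial distribution and Markov property.\<close>

lemma chain_law_initial:
  assumes K: "K \<in> S \<rightarrow>\<^sub>M prob_algebra S" and lam: "lam \<in> space (prob_algebra S)"
  shows "distr (chain_law S K lam) S (\<lambda>\<omega>. \<omega> 0) = lam"
proof -
  interpret Ionescu_Tulcea "chain_step K lam" "\<lambda>_. S"
    using assms by (rule Ionescu_Tulcea_chain_step)
  note sets_chain_law[OF K lam, measurable_cong]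
  have sl: "sets lam = sets S" using lam by (simp add: space_prob_algebra)
  have r: "(\<lambda>\<omega>. restrict \<omega> {0..<Suc 0}) \<in> chain_law S K lam \<rightarrow>\<^sub>M PiM {0..<Suc 0} (\<lambda>_. S)"
    by (subst measurable_cong_sets[OF sets_chain_law[OF K lam] refl]) (rule measurable_restrict_subset, simp)
  have c: "(\<lambda>\<omega>. \<omega> 0) \<in> PiM {0..<Suc 0} (\<lambda>_. S) \<rightarrow>\<^sub>M S"
    by (rule measurable_component_singleton) simp
  have u: "(\<lambda>_. undefined) \<in> space (PiM {0..<0::nat} (\<lambda>_. S))" by (simp add: space_PiM_empty)
  have fu: "fun_upd (\<lambda>_. undefined) 0 \<in> lam \<rightarrow>\<^sub>M PiM {0..<Suc 0} (\<lambda>_. S)"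
    using u by (subst measurable_cong_sets[OF sl refl]) (rule measurable_fun_upd[where J="{0..<0}"], auto)
  have "distr (chain_law S K lam) S (\<lambda>\<omega>. \<omega> 0) =
      distr (distr (chain_law S K lam) (PiM {0..<Suc 0} (\<lambda>_. S)) (\<lambda>\<omega>. restrict \<omega> {0..<Suc 0})) S (\<lambda>\<omega>. \<omega> 0)"
    by (subst distr_distr[OF c r]) (simp add: comp_def)
  also have "\<dots> = distr (C 0 (Suc 0) (\<lambda>_. undefined)) S (\<lambda>\<omega>. \<omega> 0)"
    by (simp only: distr_restrict_chain_law[OF K lam])
  also have "C 0 (Suc 0) (\<lambda>_. undefined) = eP 0 (\<lambda>_. undefined)"
    using bind_return[OF measurable_eP u] by simp
  also have "eP 0 (\<lambda>_. undefined) = distr lam (PiM {0..<Suc 0} (\<lambda>_. S)) (fun_upd (\<lambda>_. undefined) 0)"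
    by (simp add: eP_def chain_step_def)
  also have "distr \<dots> S (\<lambda>\<omega>. \<omega> 0) = distr lam S (\<lambda>x. x)"
    by (subst distr_distr[OF c fu]) (simp add: comp_def)
  also have "\<dots> = lam" by (rule distr_id2[OF sl[symmetric]])
  finally show ?thesis .
qed

lemma chain_law_Markov:
  assumes K: "K \<in> S \<rightarrow>\<^sub>M prob_algebra S" and lam: "lam \<in> space (prob_algebra S)"
    and B: "B \<in> sets (PiM {0..<Suc n} (\<lambda>_. S))" and A: "A \<in> sets S"
  shows "emeasure (chain_law S K lam)
      {\<omega> \<in> space (chain_law S K lam). restrict \<omega> {0..<Suc n} \<in> B \<and> \<omega> (Suc n) \<in> A}
    = (\<integral>\<^sup>+\<omega>. indicator B (restrict \<omega> {0..<Suc n}) * emeasure (K (\<omega> n)) A \<partial>chain_law S K lam)"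
proof -
  interpret Ionescu_Tulcea "chain_step K lam" "\<lambda>_. S"
    using assms(1,2) by (rule Ionescu_Tulcea_chain_step)
  let ?P = "chain_law S K lam" and ?n = "Suc n" and ?u = "\<lambda>_::nat. undefined :: 'a"
  let ?M = "\<lambda>k::nat. PiM {0..<k} (\<lambda>_. S)"
  have r: "(\<lambda>\<omega>. restrict \<omega> {0..<k}) \<in> ?P \<rightarrow>\<^sub>M ?M k" for k
    by (subst measurable_cong_sets[OF sets_chain_law[OF K lam] refl]) (rule measurable_restrict_subset, simp)
  have u: "?u \<in> space (?M 0)" by (simp add: space_PiM_empty)
  have [measurable]: "B \<in> sets (?M ?n)" "A \<in> sets S" by fact+
  have rr: "(\<lambda>\<omega>. restrict \<omega> {0..<?n}) \<in> ?M (Suc ?n) \<rightarrow>\<^sub>M ?M ?n"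
    by (rule measurable_restrict_subset) simp
  have cc: "(\<lambda>\<omega>. \<omega> ?n) \<in> ?M (Suc ?n) \<rightarrow>\<^sub>M S"
    by (rule measurable_component_singleton) simp
  have cn: "(\<lambda>\<omega>. \<omega> n) \<in> ?M ?n \<rightarrow>\<^sub>M S"
    by (rule measurable_component_singleton) simp
  define E where "E = {\<omega> \<in> space (?M (Suc ?n)). restrict \<omega> {0..<?n} \<in> B \<and> \<omega> ?n \<in> A}"
  have E: "E \<in> sets (?M (Suc ?n))"
    unfolding E_def using measurable_sets_Collect[OF rr, of "\<lambda>x. x \<in> B"]
      measurable_sets_Collect[OF cc, of "\<lambda>x. x \<in> A"] B A
    by (intro sets.sets_Collect_conj) (auto simp: sets.sets_into_space Collect_conj_eq Int_absorb1 Int_commute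
        dest: sets.sets_into_space)
  have KA: "(\<lambda>\<omega>. indicator B \<omega> * emeasure (K (\<omega> n)) A) \<in> borel_measurable (?M ?n)"
    using measurable_compose[OF cn measurable_prob_algebraD[OF K]] 
    by measurable
  have "{\<omega> \<in> space ?P. restrict \<omega> {0..<?n} \<in> B \<and> \<omega> ?n \<in> A}
      = (\<lambda>\<omega>. restrict \<omega> {0..<Suc ?n}) -` E \<inter> space ?P"
    using measurable_space[OF r, of _ "Suc ?n"]
    by (auto simp: E_def Int_absorb1 restrict_restrict atLeastLessThanSuc space_PiM)
  then have "emeasure ?P {\<omega> \<in> space ?P. restrict \<omega> {0..<?n} \<in> B \<and> \<omega> ?n \<in> A}
      = emeasure (distr ?P (?M (Suc ?n)) (\<lambda>\<omega>. restrict \<omega> {0..<Suc ?n})) E"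
    by (simp add: emeasure_distr[OF r E])
  also have "\<dots> = emeasure (C 0 ?n ?u \<bind> eP ?n) E"
    by (simp only: distr_restrict_chain_law[OF K lam] C.simps add_0)
  also have "\<dots> = (\<integral>\<^sup>+\<omega>. emeasure (eP ?n \<omega>) E \<partial>C 0 ?n ?u)"
  proof (rule emeasure_bind[OF _ _ E])
    show "space (C 0 ?n ?u) \<noteq> {}" by (rule prob_space.not_empty[OF prob_space_C[OF u]])
    show "eP ?n \<in> C 0 ?n ?u \<rightarrow>\<^sub>M subprob_algebra (?M (Suc ?n))"
      using measurable_eP[of ?n] by (subst measurable_cong_sets[OF sets_C[OF u, of ?n] refl]) (simp only: add_0)
  qed
  also have "\<dots> = (\<integral>\<^sup>+\<omega>. indicator B \<omega> * emeasure (K (\<omega> n)) A \<partial>C 0 ?n ?u)"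
  proof (rule nn_integral_cong)
    fix \<omega> assume "\<omega> \<in> space (C 0 ?n ?u)"
    then have w: "\<omega> \<in> space (?M ?n)" using space_C[OF u, of ?n] by simp
    have wn: "\<omega> n \<in> space S" using w by (auto simp: space_PiM PiE_iff)
    have "restrict (fun_upd \<omega> ?n x) {0..<?n} = \<omega>" for x
      using w by (auto simp: space_PiM PiE_def extensional_def restrict_def)
    then have "(\<lambda>x. fun_upd \<omega> ?n x) -` E \<inter> space S = (if \<omega> \<in> B then A else {})"
      using w sets.sets_into_space[OF A]
      by (auto simp: E_def space_PiM PiE_iff extensional_def)
    then show "emeasure (eP ?n \<omega>) E = indicator B \<omega> * emeasure (K (\<omega> n)) A"
      using emeasure_eP[OF w E] by (simp add: chain_step_def)
  qed
  also have "\<dots> = (\<integral>\<^sup>+\<omega>. indicator B \<omega> * emeasure (K (\<omega> n)) A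
      \<partial>distr ?P (?M ?n) (\<lambda>\<omega>. restrict \<omega> {0..<?n}))"
    by (simp only: distr_restrict_chain_law[OF K lam])
  also have "\<dots> = (\<integral>\<^sup>+\<omega>. indicator B (restrict \<omega> {0..<?n}) * emeasure (K (\<omega> n)) A \<partial>?P)"
    using KA by (subst nn_integral_distr[OF r]) simp_all
  finally show ?thesis .
qed

definition harris_recurrent :: "'a measure \<Rightarrow> ('a \<Rightarrow> 'a measure) \<Rightarrow> bool"
  where "harris_recurrent S K \<longleftrightarrow>
    (\<exists>\<phi>. sets \<phi> = sets S \<and> sigma_finite_measure \<phi> \<and> emeasure \<phi> (space S) > 0 \<and>
      (\<forall>A\<in>sets S. emeasure \<phi> A > 0 \<longrightarrow>
        (\<forall>s\<in>space S. AE \<omega> in chain_law S K (return S s). \<exists>\<^sub>\<infinity>n. \<omega> n \<in> A)))"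

definition stationary_distribution :: "'a measure \<Rightarrow> ('a \<Rightarrow> 'a measure) \<Rightarrow> 'a measure \<Rightarrow> bool"
  where "stationary_distribution S K p \<longleftrightarrow> p \<in> space (prob_algebra S) \<and> p \<bind> K = p"

definition positive_harris :: "'a measure \<Rightarrow> ('a \<Rightarrow> 'a measure) \<Rightarrow> bool"
  where "positive_harris S K \<longleftrightarrow> harris_recurrent S K \<and> (\<exists>p. stationary_distribution S K p)"

text \<open>
  Nonemptiness of the classes need not be demanded: if \<open>p\<close> is stationary, all classes of a cyclic
  decomposition have the same \<open>p\<close>-mass \<open>1 / d\<close>.
\<close>

definition cyclic_decomposition ::
    "'a measure \<Rightarrow> ('a \<Rightarrow> 'a measure) \<Rightarrow> 'a measure \<Rightarrow> nat \<Rightarrow> (nat \<Rightarrow> 'a set) \<Rightarrow> bool"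
  where "cyclic_decomposition S K p d D \<longleftrightarrow>
    D ` {..<d} \<subseteq> sets S \<and> disjoint_family_on D {..<d} \<and>
    emeasure p (space S - (\<Union>i<d. D i)) = 0 \<and>
    (\<forall>i<d. \<forall>s\<in>D i. emeasure (K s) (D (Suc i mod d)) = 1)"

definition aperiodic :: "'a measure \<Rightarrow> ('a \<Rightarrow> 'a measure) \<Rightarrow> 'a measure \<Rightarrow> bool"
  where "aperiodic S K p \<longleftrightarrow> \<not> (\<exists>d\<ge>2. \<exists>D. cyclic_decomposition S K p d D)"


section \<open>Phantom distribution functions\<close>

definition distribution_function :: "(real \<Rightarrow> real) \<Rightarrow> bool"
  where "distribution_function G \<longleftrightarrow> (\<exists>\<mu>. real_distribution \<mu> \<and> G = cdf \<mu>)"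

text \<open>Meaningful for \<open>n \<ge> 1\<close> only; the value at \<open>n = 0\<close> plays no role in the limit below.\<close>

definition partial_max :: "(nat \<Rightarrow> 'w \<Rightarrow> real) \<Rightarrow> nat \<Rightarrow> 'w \<Rightarrow> real"
  where "partial_max X n \<omega> = Max ((\<lambda>j. X j \<omega>) ` {..<n})"

definition phantom_distribution_function ::
    "'w measure \<Rightarrow> (nat \<Rightarrow> 'w \<Rightarrow> real) \<Rightarrow> (real \<Rightarrow> real) \<Rightarrow> bool"
  where "phantom_distribution_function P X G \<longleftrightarrow> distribution_function G \<and>
    (\<lambda>n. SUP x. \<bar>measure P {\<omega> \<in> space P. partial_max X n \<omega> \<le> x} - G x ^ n\<bar>) \<longlonglongrightarrow> 0"

definition continuous_phantom ::
    "'w measure \<Rightarrow> (nat \<Rightarrow> 'w \<Rightarrow> real) \<Rightarrow> (real \<Rightarrow> real) \<Rightarrow> bool"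
  where "continuous_phantom P X G \<longleftrightarrow>
    phantom_distribution_function P X G \<and> continuous_on UNIV G"

end

theory Submission
  imports Defs
begin

text \<open>
  Write \<open>F lam n x\<close> for the probability, under the initial law \<open>lam\<close>, that the first \<open>n\<close> values of
  \<open>f\<close> along the chain are at most \<open>x\<close>.  The link between an arbitrary initial law \<open>lam\<close> and the
  stationary law \<open>p\<close> is the convergence in total variation of the Cesaro averages
  \<open>(law lam 0 + \<dots> + law lam (J - 1)) / J\<close> to \<open>p\<close> (\<open>cesaro_total_variation\<close>).  Averages suffice because
  a maximum is insensitive to a bounded shift of the observation window: for \<open>j < J\<close> the window
  \<open>[j, j + n)\<close> lies inside \<open>[0, n + J)\<close> and, together with \<open>[0, J)\<close>, covers \<open>[0, n)\<close>.  Averaging over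
  \<open>j\<close> gives, uniformly in \<open>n\<close> and \<open>x\<close>, the sandwich
  \<open>F lam (n + J) x - e \<le> F p n x \<le> F lam n x + (1 - F lam J x) + e\<close> (\<open>max_cdf_sandwich\<close>).

  Since \<open>G ^ n - G ^ (n + J)\<close> is uniformly of order \<open>J / n\<close>, the only obstacle to passing a phantom distribution
  function from one side of the sandwich to the other is the term \<open>1 - F lam J x\<close>.  It is harmless if
  it can be made small at some level \<open>x\<close> with \<open>G x < 1\<close>: above that level it stays small, and below it
  both \<open>G ^ n\<close> and the distribution of the maximum vanish in the limit (\<open>sandwich_phantom_iff\<close>).
  Continuity of \<open>G\<close> forces this tail condition under every initial law that has \<open>G\<close> as a phantom
  distribution function (\<open>phantom_imp_tail\<close>).  The condition holds for \<open>lam\<close> exactly when \<open>lam\<close> does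
  not charge the set of points from which the chain can reach \<open>{G \<circ> f = 1}\<close>
  (\<open>uniform_tail_iff_exceptional_set_null\<close>), which is therefore the null set asked for in the second
  half of the theorem.

  The total variation theorem rests on a Liouville property.  If the averages stayed away from \<open>p\<close>,
  testing them would produce functions \<open>v\<^sub>n\<close> with values in \<open>[0, 1]\<close> that are harmonic up to \<open>1 / n\<close>
  and whose integrals against \<open>lam\<close> and \<open>p\<close> differ by a fixed amount.  Both requirements are convex, so
  minimising the \<open>L\<^sup>2\<close> norm selects an almost everywhere convergent sequence of such functions
  (\<open>convergent_selection_midpoint_convex\<close>), whose limit is harmonic almost everywhere.  Harris
  recurrence makes it constant: some set on which it stays within \<open>e\<close> of a constant is positive for
  the recurrence measure, and the value anywhere is the mean of the value at the time of the first
  visit to that set (\<open>almost_harmonic_nearly_constant\<close>).  A constant integrates equally against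
  \<open>lam\<close> and \<open>p\<close>, a contradiction.
\<close>

section \<open>Measurable functions with values in the unit interval\<close>

definition unit_functions :: "'a measure \<Rightarrow> ('a \<Rightarrow> real) set"
  where "unit_functions M = {h \<in> borel_measurable M. \<forall>s\<in>space M. 0 \<le> h s \<and> h s \<le> 1}"

lemma unit_functionsI:
  "h \<in> borel_measurable M \<Longrightarrow> (\<And>s. s \<in> space M \<Longrightarrow> 0 \<le> h s) \<Longrightarrow> (\<And>s. s \<in> space M \<Longrightarrow> h s \<le> 1)
    \<Longrightarrow> h \<in> unit_functions M"
  by (auto simp: unit_functions_def)

lemma unit_functionsD:
  assumes "h \<in> unit_functions M"
  shows "h \<in> borel_measurable M" "\<And>s. s \<in> space M \<Longrightarrow> 0 \<le> h s" "\<And>s. s \<in> space M \<Longrightarrow> h s \<le> 1"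
  using assms by (auto simp: unit_functions_def)

lemma unit_functions_cong_sets: "sets M = sets N \<Longrightarrow> unit_functions M = unit_functions N"
  by (simp add: unit_functions_def measurable_cong_sets[of M N borel borel] sets_eq_imp_space_eq[of M N])

lemma integrable_unit_function:
  assumes M: "M \<in> space (prob_algebra S)" and h: "h \<in> unit_functions S"
  shows "integrable M h"
proof -
  have sets: "sets M = sets S" and "prob_space M" using M by (auto simp: space_prob_algebra)
  then interpret prob_space M by simp
  from h have h': "h \<in> unit_functions M" by (simp add: unit_functions_cong_sets[OF sets])
  show ?thesis
    by (rule integrable_const_bound[where B=1]) (use unit_functionsD[OF h'] in auto)
qed

lemma integral_unit_function:
  assumes M: "M \<in> space (prob_algebra S)" and h: "h \<in> unit_functions S"
  shows "0 \<le> integral\<^sup>L M h" "integral\<^sup>L M h \<le> 1"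
proof -
  have sets: "sets M = sets S" and "prob_space M" using M by (auto simp: space_prob_algebra)
  then interpret prob_space M by simp
  have "space M = space S" by (rule sets_eq_imp_space_eq[OF sets])
  then show "0 \<le> integral\<^sup>L M h" "integral\<^sup>L M h \<le> 1"
    using integrable_unit_function[OF M h] unit_functionsD[OF h]
    by (auto intro!: integral_ge_const integral_le_const)
qed

section \<open>Transition operator and Markov property\<close>

locale markov_kernel =
  fixes S :: "'a measure" and K :: "'a \<Rightarrow> 'a measure"
  assumes kernel: "K \<in> S \<rightarrow>\<^sub>M prob_algebra S"
begin

lemma kernel_subprob[measurable]: "K \<in> S \<rightarrow>\<^sub>M subprob_algebra S"
  by (rule measurable_prob_algebraD[OF kernel])

lemma kernel_space: "s \<in> space S \<Longrightarrow> K s \<in> space (prob_algebra S)"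
  by (rule measurable_space[OF kernel])

definition transition :: "('a \<Rightarrow> real) \<Rightarrow> 'a \<Rightarrow> real"
  where "transition h s = (\<integral>t. h t \<partial>K s)"

definition law :: "'a measure \<Rightarrow> nat \<Rightarrow> 'a measure"
  where "law lam n = ((\<lambda>\<mu>. \<mu> \<bind> K) ^^ n) lam"

text \<open>
  The probability that the first \<open>n\<close> positions of the chain started at a point all lie in \<open>A\<close>,
  written as a power of the transition operator killed outside \<open>A\<close>.
\<close>

definition stay :: "'a set \<Rightarrow> nat \<Rightarrow> 'a \<Rightarrow> real"
  where "stay A n = ((\<lambda>h s. indicator A s * transition h s) ^^ n) (\<lambda>_. 1)"

lemma law_0 [simp]: "law lam 0 = lam" and law_Suc: "law lam (Suc n) = law lam n \<bind> K"
  by (simp_all add: law_def)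

lemma stay_0 [simp]: "stay A 0 s = 1"
  and stay_Suc: "stay A (Suc n) s = indicator A s * transition (stay A n) s"
  by (simp_all add: stay_def)

lemma bind_kernel_space:
  assumes "\<mu> \<in> space (prob_algebra S)" shows "\<mu> \<bind> K \<in> space (prob_algebra S)"
  by (rule measurable_space[OF measurable_bind_prob_space[OF measurable_ident kernel], simplified, OF assms])

lemma law_space: "lam \<in> space (prob_algebra S) \<Longrightarrow> law lam n \<in> space (prob_algebra S)"
  by (induction n) (auto simp: law_Suc bind_kernel_space)

lemma transition_unit:
  assumes h: "h \<in> unit_functions S" shows "transition h \<in> unit_functions S"
proof (rule unit_functionsI)
  show "transition h \<in> borel_measurable S"
    unfolding transition_def using unit_functionsD(1)[OF h] by measurable
  show "0 \<le> transition h s" "transition h s \<le> 1" if "s \<in> space S" for s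
    using integral_unit_function[OF kernel_space[OF that] h] by (auto simp: transition_def)
qed

lemma transition_power_unit:
  "h \<in> unit_functions S \<Longrightarrow> (transition ^^ n) h \<in> unit_functions S"
  by (induction n) (auto simp: transition_unit)

lemma restricted_transition_unit:
  assumes A: "A \<in> sets S" and h: "h \<in> unit_functions S"
  shows "(\<lambda>s. indicator A s * transition h s) \<in> unit_functions S"
proof (rule unit_functionsI)
  show "(\<lambda>s. indicator A s * transition h s) \<in> borel_measurable S"
    using A unit_functionsD(1)[OF transition_unit[OF h]] by measurable
qed (use unit_functionsD[OF transition_unit[OF h]] in \<open>auto simp: indicator_def\<close>)

lemma restricted_transition_power_unit:
  "A \<in> sets S \<Longrightarrow> h \<in> unit_functions S \<Longrightarrow>
    ((\<lambda>h s. indicator A s * transition h s) ^^ n) h \<in> unit_functions S"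
  by (induction n) (auto simp: restricted_transition_unit)

lemma const_1_unit: "(\<lambda>_. 1) \<in> unit_functions S"
  by (rule unit_functionsI) auto

lemma stay_unit: "A \<in> sets S \<Longrightarrow> stay A n \<in> unit_functions S"
  unfolding stay_def by (rule restricted_transition_power_unit[OF _ const_1_unit])

lemma integral_bind_kernel:
  assumes \<mu>: "\<mu> \<in> space (prob_algebra S)" and h: "h \<in> unit_functions S"
  shows "(\<integral>t. h t \<partial>(\<mu> \<bind> K)) = (\<integral>s. transition h s \<partial>\<mu>)"
proof -
  have sets: "sets \<mu> = sets S" and "prob_space \<mu>" using \<mu> by (auto simp: space_prob_algebra)
  then interpret prob_space \<mu> by simp
  have [measurable_cong]: "sets \<mu> = sets S" by fact
  show ?thesis unfolding transition_def
  proof (rule integral_bind[where B=1 and B'=1 and K=S])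
    show "AE s in \<mu>. emeasure (K s) (space (K s)) \<le> ennreal 1"
      using kernel_space sets_eq_imp_space_eq[OF sets]
      by (auto simp: space_prob_algebra prob_space.emeasure_space_1 intro!: AE_I2)
    show "K \<in> \<mu> \<rightarrow>\<^sub>M subprob_algebra S" by measurable
    show "finite_measure \<mu>" by unfold_locales
  qed (use unit_functionsD[OF h] in auto)
qed

lemma integral_law:
  assumes lam: "lam \<in> space (prob_algebra S)" and h: "h \<in> unit_functions S"
  shows "(\<integral>s. h s \<partial>law lam n) = (\<integral>s. (transition ^^ n) h s \<partial>lam)"
  using h
proof (induction n arbitrary: h)
  case (Suc n)
  show ?case
    using Suc.IH[OF transition_unit[OF Suc.prems]] integral_bind_kernel[OF law_space[OF lam] Suc.prems, of n]
    by (simp add: law_Suc funpow_swap1)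
qed simp

lemma coordinate_measurable:
  assumes "lam \<in> space (prob_algebra S)"
  shows "(\<lambda>\<omega>. \<omega> n) \<in> chain_law S K lam \<rightarrow>\<^sub>M S"
  by (subst measurable_cong_sets[OF sets_chain_law[OF kernel assms] refl])
     (rule measurable_component_singleton, simp)

lemma restrict_measurable:
  assumes "lam \<in> space (prob_algebra S)"
  shows "(\<lambda>\<omega>. restrict \<omega> {0..<n::nat}) \<in> chain_law S K lam \<rightarrow>\<^sub>M PiM {0..<n} (\<lambda>_. S)"
  by (subst measurable_cong_sets[OF sets_chain_law[OF kernel assms] refl])
     (rule measurable_restrict_subset, simp)

text \<open>
  The Markov property as an identity of measures: restricting to an event of the past changes the
  law of the present, and one application of the kernel turns the changed law of the present into
  that of the next position.  In this form it can be integrated against any bounded function.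
\<close>

lemma chain_law_past_bind:
  assumes lam: "lam \<in> space (prob_algebra S)" and B: "B \<in> sets (PiM {0..<Suc n} (\<lambda>_. S))"
  defines "D \<equiv> density (chain_law S K lam) (\<lambda>\<omega>. indicator B (restrict \<omega> {0..<Suc n}))"
  shows "distr D S (\<lambda>\<omega>. \<omega> (Suc n)) = distr D S (\<lambda>\<omega>. \<omega> n) \<bind> K"
proof -
  let ?P = "chain_law S K lam"
  interpret P: prob_space ?P by (rule prob_space_chain_law[OF kernel lam])
  note [measurable] = B coordinate_measurable[OF lam] restrict_measurable[OF lam]
  have [measurable]: "(\<lambda>\<omega>. indicator B (restrict \<omega> {0..<Suc n}) :: ennreal) \<in> borel_measurable ?P"
    by measurable
  have cD [measurable]: "(\<lambda>\<omega>. \<omega> m) \<in> D \<rightarrow>\<^sub>M S" for m unfolding D_def by measurable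
  have ne: "space S \<noteq> {}"
    using measurable_space[OF coordinate_measurable[OF lam]] P.not_empty by blast
  have sb: "sets (distr D S (\<lambda>\<omega>. \<omega> n) \<bind> K) = sets S"
    by (rule sets_bind[where N=S]) (use ne sets_kernel[OF kernel_subprob] in auto)
  show ?thesis
  proof (rule measure_eqI)
    fix A assume "A \<in> sets (distr D S (\<lambda>\<omega>. \<omega> (Suc n)))"
    then have A [measurable]: "A \<in> sets S" by simp
    have "emeasure (distr D S (\<lambda>\<omega>. \<omega> (Suc n))) A =
        emeasure D ((\<lambda>\<omega>. \<omega> (Suc n)) -` A \<inter> space ?P)"
      by (subst emeasure_distr[OF cD A]) (simp add: D_def)
    also have "\<dots> = (\<integral>\<^sup>+\<omega>. indicator B (restrict \<omega> {0..<Suc n}) *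
        indicator ((\<lambda>\<omega>. \<omega> (Suc n)) -` A \<inter> space ?P) \<omega> \<partial>?P)"
      unfolding D_def by (rule emeasure_density) measurable
    also have "\<dots> = (\<integral>\<^sup>+\<omega>. indicator {\<omega> \<in> space ?P. restrict \<omega> {0..<Suc n} \<in> B \<and> \<omega> (Suc n) \<in> A} \<omega> \<partial>?P)"
      by (intro nn_integral_cong) (auto split: split_indicator)
    also have "\<dots> = emeasure ?P {\<omega> \<in> space ?P. restrict \<omega> {0..<Suc n} \<in> B \<and> \<omega> (Suc n) \<in> A}"
      by (rule nn_integral_indicator) measurable
    also have "\<dots> = (\<integral>\<^sup>+\<omega>. indicator B (restrict \<omega> {0..<Suc n}) * emeasure (K (\<omega> n)) A \<partial>?P)"
      by (rule chain_law_Markov[OF kernel lam B A])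
    also have "\<dots> = (\<integral>\<^sup>+\<omega>. emeasure (K (\<omega> n)) A \<partial>D)"
      unfolding D_def by (subst nn_integral_density) auto
    also have "\<dots> = (\<integral>\<^sup>+s. emeasure (K s) A \<partial>distr D S (\<lambda>\<omega>. \<omega> n))"
      by (subst nn_integral_distr) auto
    also have "\<dots> = emeasure (distr D S (\<lambda>\<omega>. \<omega> n) \<bind> K) A"
      using ne by (intro emeasure_bind[where N=S, symmetric]) auto
    finally show "emeasure (distr D S (\<lambda>\<omega>. \<omega> (Suc n))) A = emeasure (distr D S (\<lambda>\<omega>. \<omega> n) \<bind> K) A" .
  qed (simp add: sb)
qed

lemma markov_property:
  assumes lam: "lam \<in> space (prob_algebra S)" and B: "B \<in> sets (PiM {0..<Suc n} (\<lambda>_. S))"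
    and h: "h \<in> unit_functions S"
  shows "(\<integral>\<omega>. indicator B (restrict \<omega> {0..<Suc n}) * h (\<omega> (Suc n)) \<partial>chain_law S K lam)
    = (\<integral>\<omega>. indicator B (restrict \<omega> {0..<Suc n}) * transition h (\<omega> n) \<partial>chain_law S K lam)"
proof -
  let ?P = "chain_law S K lam"
  interpret P: prob_space ?P by (rule prob_space_chain_law[OF kernel lam])
  note [measurable] = B coordinate_measurable[OF lam] restrict_measurable[OF lam]
    unit_functionsD(1)[OF h] unit_functionsD(1)[OF transition_unit[OF h]]
  define b :: "(nat \<Rightarrow> 'a) \<Rightarrow> real" where "b \<omega> = indicator B (restrict \<omega> {0..<Suc n})" for \<omega>
  have [measurable]: "b \<in> borel_measurable ?P" unfolding b_def by measurable
  have b0: "0 \<le> b \<omega>" for \<omega> by (simp add: b_def)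
  define D where "D = density ?P (\<lambda>\<omega>. ennreal (b \<omega>))"
  have D: "D = density ?P (\<lambda>\<omega>. indicator B (restrict \<omega> {0..<Suc n}))"
    unfolding D_def b_def by (simp add: ennreal_indicator)
  have cD [measurable]: "(\<lambda>\<omega>. \<omega> m) \<in> D \<rightarrow>\<^sub>M S" for m unfolding D_def by measurable
  have "emeasure D (space D) = emeasure D (space ?P)" by (simp add: D_def)
  also have "\<dots> = (\<integral>\<^sup>+\<omega>. ennreal (b \<omega>) * indicator (space ?P) \<omega> \<partial>?P)"
    unfolding D_def by (rule emeasure_density) auto
  also have "\<dots> \<le> (\<integral>\<^sup>+\<omega>. 1 \<partial>?P)"
    by (intro nn_integral_mono) (auto simp: b_def split: split_indicator)
  finally have "emeasure D (space D) \<noteq> \<infinity>"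
    by (auto simp: P.emeasure_space_1 top_unique)
  then interpret D: finite_measure D by (rule finite_measureI)
  interpret Dn: finite_measure "distr D S (\<lambda>\<omega>. \<omega> n)"
    by (rule D.finite_measure_distr) measurable
  have "(\<integral>\<omega>. b \<omega> * h (\<omega> (Suc n)) \<partial>?P) = (\<integral>\<omega>. h (\<omega> (Suc n)) \<partial>D)"
    unfolding D_def by (subst integral_density) (auto simp: b0)
  also have "\<dots> = (\<integral>s. h s \<partial>distr D S (\<lambda>\<omega>. \<omega> (Suc n)))"
    by (subst integral_distr) auto
  also have "\<dots> = (\<integral>s. h s \<partial>(distr D S (\<lambda>\<omega>. \<omega> n) \<bind> K))"
    unfolding D by (simp only: chain_law_past_bind[OF lam B])
  also have "\<dots> = (\<integral>s. transition h s \<partial>distr D S (\<lambda>\<omega>. \<omega> n))"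
    unfolding transition_def
  proof (rule integral_bind[where B=1 and B'=1 and K=S])
    show "AE s in distr D S (\<lambda>\<omega>. \<omega> n). emeasure (K s) (space (K s)) \<le> ennreal 1"
      using kernel_space by (auto simp: space_prob_algebra prob_space.emeasure_space_1 intro!: AE_I2)
    show "finite_measure (distr D S (\<lambda>\<omega>. \<omega> n))" by unfold_locales
  qed (use unit_functionsD[OF h] in auto)
  also have "\<dots> = (\<integral>\<omega>. transition h (\<omega> n) \<partial>D)"
    by (subst integral_distr) auto
  also have "\<dots> = (\<integral>\<omega>. b \<omega> * transition h (\<omega> n) \<partial>?P)"
    unfolding D_def by (subst integral_density) (auto simp: b0)
  finally show ?thesis by (simp add: b_def)
qed

lemma integral_coordinate:
  assumes lam: "lam \<in> space (prob_algebra S)" and h: "h \<in> unit_functions S"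
  shows "(\<integral>\<omega>. h (\<omega> n) \<partial>chain_law S K lam) = (\<integral>s. h s \<partial>law lam n)"
  using h
proof (induction n arbitrary: h)
  case 0
  have "(\<integral>s. h s \<partial>distr (chain_law S K lam) S (\<lambda>\<omega>. \<omega> 0)) = (\<integral>\<omega>. h (\<omega> 0) \<partial>chain_law S K lam)"
    by (rule integral_distr[OF coordinate_measurable[OF lam] unit_functionsD(1)[OF 0]])
  then show ?case by (simp add: chain_law_initial[OF kernel lam])
next
  case (Suc n)
  let ?B = "space (PiM {0..<Suc n} (\<lambda>_. S))"
  have sB: "?B \<in> sets (PiM {0..<Suc n} (\<lambda>_. S))" by simp
  have all: "restrict \<omega> {0..<Suc n} \<in> ?B" if "\<omega> \<in> space (chain_law S K lam)" for \<omega>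
    using measurable_space[OF restrict_measurable[OF lam] that] .
  have "(\<integral>\<omega>. h (\<omega> (Suc n)) \<partial>chain_law S K lam) = (\<integral>\<omega>. transition h (\<omega> n) \<partial>chain_law S K lam)"
    using markov_property[OF lam sB Suc.prems] all
    by (simp cong: Bochner_Integration.integral_cong)
  then show ?case
    using Suc.IH[OF transition_unit[OF Suc.prems]] integral_bind_kernel[OF law_space[OF lam] Suc.prems, of n]
    by (simp add: law_Suc)
qed

lemma window_measurable:
  assumes lam: "lam \<in> space (prob_algebra S)" and A: "A \<in> sets S"
  shows "{\<omega> \<in> space (chain_law S K lam). \<forall>i<n::nat. \<omega> (j + i) \<in> A} \<in> sets (chain_law S K lam)"
proof -
  note [measurable] = coordinate_measurable[OF lam] A
  show ?thesis by measurable
qed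

text \<open>
  The last position in the window is integrated out first: by the Markov property this replaces the
  test function by its transition, killed outside \<open>A\<close>, and shortens the window by one.
\<close>

lemma integral_window:
  assumes lam: "lam \<in> space (prob_algebra S)" and A: "A \<in> sets S" and h: "h \<in> unit_functions S"
  shows "(\<integral>\<omega>. indicator {\<omega>. \<forall>i<n. \<omega> (j + i) \<in> A} \<omega> * h (\<omega> (j + n)) \<partial>chain_law S K lam)
    = (\<integral>s. ((\<lambda>h s. indicator A s * transition h s) ^^ n) h s \<partial>law lam j)"
  using h
proof (induction n arbitrary: h)
  case 0
  then show ?case by (simp add: integral_coordinate[OF lam])
next
  case (Suc n)
  let ?P = "chain_law S K lam" and ?T = "\<lambda>h s. indicator A s * transition h s"
  define B where "B = {\<eta> \<in> space (PiM {0..<Suc (j + n)} (\<lambda>_. S)). \<forall>i<Suc n. \<eta> (j + i) \<in> A}"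
  have B: "B \<in> sets (PiM {0..<Suc (j + n)} (\<lambda>_. S))"
  proof -
    have [measurable]: "A \<in> sets S" by fact
    have "B = {\<eta> \<in> space (PiM {0..<Suc (j + n)} (\<lambda>_. S)). \<forall>i\<in>{..<Suc n}. \<eta> (j + i) \<in> A}"
      by (auto simp: B_def)
    also have "\<dots> \<in> sets (PiM {0..<Suc (j + n)} (\<lambda>_. S))"
    proof (rule sets.sets_Collect_finite_All)
      fix i assume "i \<in> {..<Suc n}"
      then have c: "(\<lambda>\<eta>. \<eta> (j + i)) \<in> PiM {0..<Suc (j + n)} (\<lambda>_. S) \<rightarrow>\<^sub>M S"
        by (intro measurable_component_singleton) auto
      show "{\<eta> \<in> space (PiM {0..<Suc (j + n)} (\<lambda>_. S)). \<eta> (j + i) \<in> A}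
          \<in> sets (PiM {0..<Suc (j + n)} (\<lambda>_. S))"
        using measurable_sets[OF c A] by (simp add: vimage_def Int_def conj_commute)
    qed simp
    finally show ?thesis .
  qed
  have iB: "indicator B (restrict \<omega> {0..<Suc (j + n)}) = (indicator {\<omega>. \<forall>i<Suc n. \<omega> (j + i) \<in> A} \<omega> :: real)"
    if "\<omega> \<in> space ?P" for \<omega>
    using measurable_space[OF restrict_measurable[OF lam, of "Suc (j + n)"] that]
    by (auto simp: B_def indicator_def)
  have "(\<integral>\<omega>. indicator {\<omega>. \<forall>i<Suc n. \<omega> (j + i) \<in> A} \<omega> * h (\<omega> (j + Suc n)) \<partial>?P)
      = (\<integral>\<omega>. indicator B (restrict \<omega> {0..<Suc (j + n)}) * h (\<omega> (Suc (j + n))) \<partial>?P)"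
    by (intro Bochner_Integration.integral_cong) (simp_all only: iB add_Suc_right)
  also have "\<dots> = (\<integral>\<omega>. indicator B (restrict \<omega> {0..<Suc (j + n)}) * transition h (\<omega> (j + n)) \<partial>?P)"
    by (rule markov_property[OF lam B Suc.prems])
  also have "\<dots> = (\<integral>\<omega>. indicator {\<omega>. \<forall>i<n. \<omega> (j + i) \<in> A} \<omega> * ?T h (\<omega> (j + n)) \<partial>?P)"
  proof (intro Bochner_Integration.integral_cong refl)
    fix \<omega> assume "\<omega> \<in> space ?P"
    from iB[OF this]
    show "indicator B (restrict \<omega> {0..<Suc (j + n)}) * transition h (\<omega> (j + n))
        = indicator {\<omega>. \<forall>i<n. \<omega> (j + i) \<in> A} \<omega> * ?T h (\<omega> (j + n))"
      by (simp add: indicator_def less_Suc_eq all_conj_distrib)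
  qed
  also have "\<dots> = (\<integral>s. (?T ^^ n) (?T h) s \<partial>law lam j)"
    by (rule Suc.IH[OF restricted_transition_unit[OF A Suc.prems]])
  also have "(?T ^^ n) (?T h) = (?T ^^ Suc n) h"
    by (subst funpow_Suc_right) simp
  finally show ?case .
qed

text \<open>
  The bridge between events of the path space and the operator calculus; with the chain started at
  a point it identifies the values of \<open>stay\<close>.
\<close>

lemma measure_window:
  assumes lam: "lam \<in> space (prob_algebra S)" and A: "A \<in> sets S"
  shows "measure (chain_law S K lam) {\<omega> \<in> space (chain_law S K lam). \<forall>i<n. \<omega> (j + i) \<in> A}
    = (\<integral>s. stay A n s \<partial>law lam j)"
proof -
  let ?P = "chain_law S K lam"
  interpret P: prob_space ?P by (rule prob_space_chain_law[OF kernel lam])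
  define E where "E = {\<omega> \<in> space ?P. \<forall>i<n. \<omega> (j + i) \<in> A}"
  have "E \<in> sets ?P" unfolding E_def by (rule window_measurable[OF lam A])
  then have "measure ?P E = (\<integral>\<omega>. indicator E \<omega> \<partial>?P)"
    using sets.sets_into_space[of E ?P] by (simp add: Int_absorb2)
  also have "\<dots> = (\<integral>\<omega>. indicator {\<omega>. \<forall>i<n. \<omega> (j + i) \<in> A} \<omega> * 1 \<partial>?P)"
    by (intro Bochner_Integration.integral_cong refl) (auto simp: E_def indicator_def)
  also have "\<dots> = (\<integral>s. stay A n s \<partial>law lam j)"
    unfolding stay_def by (rule integral_window[OF lam A const_1_unit])
  finally show ?thesis by (simp only: E_def)
qed

end

section \<open>Selecting convergent sequences from convex classes\<close>

lemma AE_summable_differences_imp_convergent: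
  fixes v :: "nat \<Rightarrow> 'a \<Rightarrow> real"
  assumes meas: "\<And>i. v i \<in> borel_measurable m"
    and int: "\<And>i. integrable m (\<lambda>s. \<bar>v i s - v (Suc i) s\<bar>)"
    and le: "\<And>i. (\<integral>s. \<bar>v i s - v (Suc i) s\<bar> \<partial>m) \<le> (1 / 2) ^ i"
  shows "AE s in m. convergent (\<lambda>i. v i s)"
proof -
  note [measurable] = meas
  have "(\<integral>\<^sup>+s. (\<Sum>i. ennreal \<bar>v i s - v (Suc i) s\<bar>) \<partial>m) = (\<Sum>i. \<integral>\<^sup>+s. ennreal \<bar>v i s - v (Suc i) s\<bar> \<partial>m)"
    by (rule nn_integral_suminf) measurable
  also have "\<dots> = (\<Sum>i. ennreal (\<integral>s. \<bar>v i s - v (Suc i) s\<bar> \<partial>m))"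
    by (intro suminf_cong nn_integral_eq_integral int) auto
  also have "\<dots> \<le> (\<Sum>i. ennreal ((1 / 2) ^ i))"
    by (intro suminf_le ennreal_leI le) auto
  also have "\<dots> = ennreal (\<Sum>i. (1 / 2) ^ i)"
    by (intro suminf_ennreal2 summable_geometric) auto
  finally have "(\<integral>\<^sup>+s. (\<Sum>i. ennreal \<bar>v i s - v (Suc i) s\<bar>) \<partial>m) \<noteq> \<infinity>"
    by (auto simp: top_unique)
  then have "AE s in m. (\<Sum>i. ennreal \<bar>v i s - v (Suc i) s\<bar>) \<noteq> \<infinity>"
    by (intro nn_integral_PInf_AE) auto
  then show ?thesis
  proof (rule AE_mp, intro AE_I2 impI)
    fix s assume "(\<Sum>i. ennreal \<bar>v i s - v (Suc i) s\<bar>) \<noteq> \<infinity>"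
    then have "summable (\<lambda>i. \<bar>v i s - v (Suc i) s\<bar>)"
      by (intro summable_suminf_not_top) auto
    then have "summable (\<lambda>i. v i s - v (Suc i) s)"
      by (rule summable_rabs_cancel)
    then have "convergent (\<lambda>n. \<Sum>i<n. v i s - v (Suc i) s)"
      by (simp add: summable_iff_convergent)
    then have "convergent (\<lambda>n. v 0 s - v n s)"
      by (simp only: sum_lessThan_telescope'[of "\<lambda>i. v i s"])
    then have "convergent (\<lambda>n. v 0 s - (v 0 s - v n s))"
      by (rule convergent_diff[OF convergent_const])
    then show "convergent (\<lambda>n. v n s)"
      by (simp only: diff_diff_eq2 add_diff_cancel_left')
  qed
qed

text \<open>
  A substitute for weak compactness.  Choose \<open>v n\<close> in \<open>C n\<close> with almost minimal \<open>L\<^sup>2\<close> norm.  The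
  minimal norms increase to a limit, and the midpoint of two almost minimal elements is itself at
  least as long as the smaller of the two minima, so the parallelogram identity makes the sequence
  Cauchy, with a rate that is summable after passing to late enough classes.
\<close>

lemma convergent_selection_midpoint_convex:
  fixes C :: "nat \<Rightarrow> ('a \<Rightarrow> real) set"
  assumes m: "prob_space m"
    and unit: "\<And>n. C n \<subseteq> unit_functions m"
    and nonempty: "\<And>n. C n \<noteq> {}"
    and decseq: "decseq C"
    and midpoint: "\<And>n g h. g \<in> C n \<Longrightarrow> h \<in> C n \<Longrightarrow> (\<lambda>s. (g s + h s) / 2) \<in> C n"
  shows "\<exists>v. (\<forall>n. v n \<in> C n) \<and> (AE s in m. convergent (\<lambda>n. v n s))"
proof -
  interpret prob_space m by fact
  let ?N = "\<lambda>g. \<integral>s. (g s)\<^sup>2 \<partial>m"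
  define J where "J n = Inf (?N ` C n)" for n
  have m_space: "m \<in> space (prob_algebra m)" by (simp add: space_prob_algebra m)
  have sq_unit: "(\<lambda>s. (g s)\<^sup>2) \<in> unit_functions m" if "g \<in> unit_functions m" for g
    using unit_functionsD[OF that] by (intro unit_functionsI) (auto intro: power_le_one)
  have N01: "0 \<le> ?N g" "?N g \<le> 1" if "g \<in> C n" for g n
    using integral_unit_function[OF m_space sq_unit] unit that by blast+
  have bdd: "bdd_below (?N ` C n)" for n by (rule bdd_belowI[of _ 0]) (auto simp: N01)
  have J_le: "J n \<le> ?N g" if "g \<in> C n" for g n
    unfolding J_def by (rule cInf_lower) (use that bdd in auto)
  have J_approx: "\<exists>g\<in>C n. ?N g < J n + e" if "e > 0" for n e
    using cInf_lessD[of "?N ` C n" "J n + e"] nonempty[of n] that by (auto simp: J_def)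
  have J_inc: "incseq J"
    unfolding J_def using decseq nonempty bdd
    by (intro incseq_SucI cInf_superset_mono) (auto simp: decseq_Suc_iff)
  have J_le_1: "J n \<le> 1" for n using nonempty[of n] J_le N01(2) by (meson ex_in_conv order_trans)
  obtain L where L: "J \<longlonglongrightarrow> L" "\<And>n. J n \<le> L"
    using incseq_convergent[OF J_inc] J_le_1 by blast
  \<comment> \<open>The parallelogram identity loses a factor \<open>8\<close>; the rate \<open>4\<^sup>-\<^sup>i\<close> for squares gives \<open>2\<^sup>-\<^sup>i\<close> in \<open>L\<^sup>1\<close>.\<close>
  define e :: "nat \<Rightarrow> real" where "e i = (1 / 4) ^ i / 8" for i
  have e_pos: "e i > 0" for i by (simp add: e_def)
  have e_dec: "e (Suc i) \<le> e i" for i by (simp add: e_def)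
  have "\<exists>r\<ge>i. \<forall>k\<ge>r. L - e i \<le> J k" for i
  proof -
    have "eventually (\<lambda>k. L - e i < J k) sequentially"
      using order_tendstoD(1)[OF L(1), of "L - e i"] e_pos[of i] by simp
    then obtain N where "\<And>k. k \<ge> N \<Longrightarrow> L - e i < J k" by (auto simp: eventually_sequentially)
    then show ?thesis by (intro exI[of _ "max i N"]) (auto intro: less_imp_le)
  qed
  then obtain r where r: "\<And>i. i \<le> r i" "\<And>i k. r i \<le> k \<Longrightarrow> L - e i \<le> J k" by metis
  have "\<exists>g\<in>C (r i). ?N g < J (r i) + e i" for i by (rule J_approx[OF e_pos])
  then obtain v where v: "\<And>i. v i \<in> C (r i)" "\<And>i. ?N (v i) < J (r i) + e i" by metis
  have vC: "v i \<in> C i" for i using v(1) decseqD[OF decseq r(1)] by blast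
  have vu: "v i \<in> unit_functions m" for i using v(1) unit by blast
  have [measurable]: "v i \<in> borel_measurable m" for i by (rule unit_functionsD(1)[OF vu])
  have close: "(\<integral>s. (v i s - v (Suc i) s)\<^sup>2 \<partial>m) \<le> (1 / 4) ^ i" for i
  proof -
    define n where "n = min (r i) (r (Suc i))"
    define g where "g s = (v i s + v (Suc i) s) / 2" for s
    have "v i \<in> C n" "v (Suc i) \<in> C n"
      using v(1) decseqD[OF decseq, of n "r i"] decseqD[OF decseq, of n "r (Suc i)"]
      by (auto simp: n_def)
    then have gC: "g \<in> C n" unfolding g_def by (rule midpoint)
    have "L - e i \<le> J n"
      using r(2)[of i "r i"] r(2)[of "Suc i" "r (Suc i)"] e_dec[of i]
      by (auto simp: n_def min_def)
    also have "J n \<le> ?N g" by (rule J_le[OF gC])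
    finally have mid: "L - e i \<le> ?N g" .
    have ints: "integrable m (\<lambda>s. (h s)\<^sup>2)" if "h \<in> unit_functions m" for h
      by (rule integrable_unit_function[OF m_space sq_unit[OF that]])
    have gu: "g \<in> unit_functions m" using gC unit by blast
    have "(\<integral>s. (v i s - v (Suc i) s)\<^sup>2 \<partial>m) = (\<integral>s. 2 * (v i s)\<^sup>2 + 2 * (v (Suc i) s)\<^sup>2 - 4 * (g s)\<^sup>2 \<partial>m)"
      by (intro Bochner_Integration.integral_cong refl) (simp add: g_def power2_eq_square field_simps)
    also have "\<dots> = 2 * ?N (v i) + 2 * ?N (v (Suc i)) - 4 * ?N g"
      using ints[OF vu[of i]] ints[OF vu[of "Suc i"]] ints[OF gu] by simp
    also have "\<dots> \<le> 8 * e i"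
      using v(2)[of i] v(2)[of "Suc i"] L(2)[of "r i"] L(2)[of "r (Suc i)"] e_dec[of i] mid by linarith
    finally show ?thesis by (simp add: e_def)
  qed
  have sq_int: "integrable m (\<lambda>s. (v i s - v (Suc i) s)\<^sup>2)"
    and abs_int: "integrable m (\<lambda>s. \<bar>v i s - v (Suc i) s\<bar>)" for i
  proof -
    have b: "\<bar>v i s - v (Suc i) s\<bar> \<le> 1" if "s \<in> space m" for s
      using unit_functionsD(2,3)[OF vu[of i] that] unit_functionsD(2,3)[OF vu[of "Suc i"] that] by linarith
    show "integrable m (\<lambda>s. \<bar>v i s - v (Suc i) s\<bar>)"
      by (rule integrable_const_bound[where B=1]) (use b in \<open>auto intro!: AE_I2\<close>)
    show "integrable m (\<lambda>s. (v i s - v (Suc i) s)\<^sup>2)"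
      by (rule integrable_const_bound[where B=1])
         (use b in \<open>auto intro!: AE_I2 simp: abs_square_le_1\<close>)
  qed
  have "(\<integral>s. \<bar>v i s - v (Suc i) s\<bar> \<partial>m) \<le> (1 / 2) ^ i" for i
  proof -
    define q :: real where "q = 2 ^ i"
    have q: "q > 0" by (simp add: q_def)
    \<comment> \<open>Bounds the \<open>L\<^sup>1\<close> norm by the \<open>L\<^sup>2\<close> norm, with the weight \<open>q\<close> that balances the two terms.\<close>
    have am_gm: "\<bar>d\<bar> \<le> (q * d\<^sup>2 + 1 / q) / 2" for d :: real
    proof -
      have "0 \<le> (q * \<bar>d\<bar> - 1)\<^sup>2" by simp
      then have "2 * (q * \<bar>d\<bar>) \<le> q * (q * d\<^sup>2) + 1" by (simp add: power2_eq_square algebra_simps)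
      then show ?thesis using q by (simp add: field_simps)
    qed
    have "(\<integral>s. \<bar>v i s - v (Suc i) s\<bar> \<partial>m) \<le> (\<integral>s. (q * (v i s - v (Suc i) s)\<^sup>2 + 1 / q) / 2 \<partial>m)"
      by (intro integral_mono abs_int am_gm) (use sq_int[of i] in auto)
    also have "\<dots> = (q * (\<integral>s. (v i s - v (Suc i) s)\<^sup>2 \<partial>m) + 1 / q) / 2"
      using sq_int[of i] by (simp add: prob_space)
    also have "\<dots> \<le> (q * (1 / 4) ^ i + 1 / q) / 2"
      using close[of i] q by simp
    also have "\<dots> = (1 / 2) ^ i"
    proof -
      have "(4::real) ^ i = 2 ^ i * 2 ^ i" by (simp flip: power_mult_distrib)
      then show ?thesis by (simp add: q_def power_divide)
    qed
    finally show ?thesis .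
  qed
  then have "AE s in m. convergent (\<lambda>i. v i s)"
    by (intro AE_summable_differences_imp_convergent abs_int) auto
  with vC show ?thesis by blast
qed

section \<open>Almost harmonic functions of a Harris chain\<close>

text \<open>
  A geometric mixture charges every member of the family, so its null sets are exactly the common
  null sets.  Applied to the laws at all times, it yields a single measure that the kernel maps to
  one absolutely continuous with respect to it.
\<close>

lemma countable_dominating_prob:
  fixes \<nu> :: "nat \<Rightarrow> 'a measure"
  assumes \<nu>: "\<And>i. \<nu> i \<in> space (prob_algebra S)"
  defines "m \<equiv> measure_pmf (geometric_pmf (1 / 2)) \<bind> \<nu>"
  shows "m \<in> space (prob_algebra S)"
    and "Measurable.pred S P \<Longrightarrow> (AE s in m. P s) \<longleftrightarrow> (\<forall>i. AE s in \<nu> i. P s)"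
    and "K \<in> S \<rightarrow>\<^sub>M prob_algebra S \<Longrightarrow> m \<bind> K = measure_pmf (geometric_pmf (1 / 2)) \<bind> (\<lambda>i. \<nu> i \<bind> K)"
proof -
  let ?g = "measure_pmf (geometric_pmf (1 / 2))"
  have \<nu>p: "\<nu> \<in> count_space UNIV \<rightarrow>\<^sub>M prob_algebra S" using \<nu> by simp
  have \<nu>s: "\<nu> \<in> ?g \<rightarrow>\<^sub>M subprob_algebra S"
    using measurable_prob_algebraD[OF \<nu>p] by (simp add: Pi_iff)
  have g: "?g \<in> space (prob_algebra (count_space UNIV))"
    by (auto simp: space_prob_algebra intro: prob_space_measure_pmf)
  show "m \<in> space (prob_algebra S)"
    unfolding m_def
    by (rule measurable_space[OF measurable_bind_prob_space[OF measurable_ident \<nu>p], simplified, OF g])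
  show "Measurable.pred S P \<Longrightarrow> (AE s in m. P s) \<longleftrightarrow> (\<forall>i. AE s in \<nu> i. P s)"
    unfolding m_def by (subst AE_bind[OF \<nu>s]) (auto simp: AE_measure_pmf_iff set_pmf_geometric)
  show "m \<bind> K = ?g \<bind> (\<lambda>i. \<nu> i \<bind> K)" if "K \<in> S \<rightarrow>\<^sub>M prob_algebra S"
    unfolding m_def by (rule bind_assoc[OF \<nu>s measurable_prob_algebraD[OF that]])
qed

context markov_kernel
begin

lemma stay_point_tendsto_0:
  assumes s: "s \<in> space S" and B: "B \<in> sets S"
    and visit: "AE \<omega> in chain_law S K (return S s). \<exists>\<^sub>\<infinity>n. \<omega> n \<in> B"
  shows "(\<lambda>n. stay (space S - B) n s) \<longlonglongrightarrow> 0"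
proof -
  let ?P = "chain_law S K (return S s)" and ?A = "space S - B"
  have ret: "return S s \<in> space (prob_algebra S)"
    using s by (auto simp: space_prob_algebra prob_space_return)
  have A: "?A \<in> sets S" using B by auto
  interpret P: prob_space ?P by (rule prob_space_chain_law[OF kernel ret])
  define E where "E n = {\<omega> \<in> space ?P. \<forall>i<n. \<omega> (0 + i) \<in> ?A}" for n
  have E: "E n \<in> sets ?P" for n unfolding E_def by (rule window_measurable[OF ret A])
  have stay: "measure ?P (E n) = stay ?A n s" for n
    using measure_window[OF ret A, of n 0] integral_return[OF s unit_functionsD(1)[OF stay_unit[OF A]]]
    by (simp add: E_def)
  have "(\<lambda>n. measure ?P (E n)) \<longlonglongrightarrow> measure ?P (\<Inter>n. E n)"
  proof (rule P.finite_Lim_measure_decseq)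
    show "range E \<subseteq> sets ?P" using E by blast
    show "decseq E" by (rule decseq_SucI) (auto simp: E_def)
  qed
  moreover have never: "AE \<omega> in ?P. \<omega> \<notin> (\<Inter>n. E n)"
    using visit
  proof (rule AE_mp, intro AE_I2 impI)
    fix \<omega> :: "nat \<Rightarrow> 'a" assume "\<exists>\<^sub>\<infinity>n. \<omega> n \<in> B"
    then obtain n where "\<omega> n \<in> B" using frequently_ex by blast
    then have "\<omega> \<notin> E (Suc n)" by (auto simp: E_def)
    then show "\<omega> \<notin> (\<Inter>n. E n)" by blast
  qed
  have "(\<Inter>n. E n) \<in> sets ?P" by (rule sets.countable_INT) (use E in auto)
  then have "measure ?P (\<Inter>n. E n) = 0" using never P.prob_eq_0 by blast
  ultimately show ?thesis by (simp add: stay)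
qed

text \<open>
  The interval \<open>[0, 1]\<close> is covered by finitely many intervals of radius \<open>e\<close>, so for one of them the
  set \<open>B\<close> where \<open>v\<close> takes values in it has positive \<open>\<phi>\<close>-measure.  If \<open>c\<close> is the centre, then
  \<open>\<bar>v - c\<bar>\<close> is at most \<open>e\<close> on \<open>B\<close> and at most \<open>1\<close> elsewhere.  Iterating harmonicity outside \<open>B\<close>
  bounds it by \<open>e\<close> plus the probability of not having entered \<open>B\<close> within \<open>n\<close> steps, which tends to
  \<open>0\<close> by recurrence.  Harmonicity almost everywhere is enough since the kernel preserves
  \<open>m\<close>-null sets.
\<close>

lemma almost_harmonic_nearly_constant:
  assumes m: "m \<in> space (prob_algebra S)"
    and closed: "\<And>P. Measurable.pred S P \<Longrightarrow> AE s in m. P s \<Longrightarrow> AE s in m. AE t in K s. P t"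
    and harris: "harris_recurrent S K"
    and v: "v \<in> unit_functions S" and harmonic: "AE s in m. transition v s = v s"
    and e: "e > 0"
  obtains c where "AE s in m. \<bar>v s - c\<bar> \<le> e"
proof -
  have sp: "space m = space S" using m by (auto simp: space_prob_algebra dest: sets_eq_imp_space_eq)
  note v_meas [measurable] = unit_functionsD(1)[OF v]
  note v01 = unit_functionsD(2,3)[OF v]
  from harris obtain \<phi> where \<phi>: "sets \<phi> = sets S" "emeasure \<phi> (space S) > 0"
    and visits: "\<And>A s. A \<in> sets S \<Longrightarrow> emeasure \<phi> A > 0 \<Longrightarrow> s \<in> space S \<Longrightarrow>
      AE \<omega> in chain_law S K (return S s). \<exists>\<^sub>\<infinity>n. \<omega> n \<in> A"
    unfolding harris_recurrent_def by blast
  obtain N where N: "1 / e < real N" using reals_Archimedean2 by blast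
  have N0: "real N > 0" using N e by (smt (verit) divide_pos_pos)
  have N1: "1 / real N < e" using N N0 e by (simp add: field_simps)
  define B where "B i = {s \<in> space S. \<bar>v s - real i / real N\<bar> \<le> e}" for i
  have B: "B i \<in> sets S" for i unfolding B_def by measurable
  have cover: "space S \<subseteq> (\<Union>i\<le>N. B i)"
  proof
    fix s assume s: "s \<in> space S"
    define i where "i = nat \<lfloor>v s * N\<rfloor>"
    have i: "real i \<le> v s * N" "v s * N < real i + 1"
      using v01(1)[OF s] N0 by (auto simp: i_def)
    have "real i \<le> real N" using i(1) mult_right_mono[OF v01(2)[OF s], of "real N"] by simp
    moreover have "\<bar>v s - real i / real N\<bar> \<le> 1 / real N"
    proof -
      have "\<bar>v s - real i / real N\<bar> = \<bar>v s * N - real i\<bar> / real N"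
        using N0 by (simp add: abs_if field_simps)
      then show ?thesis using i N0 by (simp add: divide_right_mono)
    qed
    ultimately show "s \<in> (\<Union>i\<le>N. B i)" using s N1 by (auto simp: B_def intro!: bexI[of _ i])
  qed
  have "\<exists>i\<le>N. emeasure \<phi> (B i) > 0"
  proof (rule ccontr)
    assume "\<not> ?thesis"
    then have "B i \<in> null_sets \<phi>" if "i \<le> N" for i
      using B \<phi>(1) that by (auto simp: null_sets_def zero_less_iff_neq_zero)
    then have "(\<Union>i\<in>{..N}. B i) \<in> null_sets \<phi>" by (intro null_sets.finite_UN) auto
    then have "space S \<in> null_sets \<phi>" by (rule null_sets_subset) (use \<phi>(1) cover in auto)
    with \<phi>(2) show False by (simp add: null_sets_def)
  qed
  then obtain i where i: "i \<le> N" "emeasure \<phi> (B i) > 0" by blast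
  define c where "c = real i / real N"
  have c01: "0 \<le> c" "c \<le> 1" using i(1) N0 by (auto simp: c_def)
  define A where "A = space S - B i"
  have A [measurable]: "A \<in> sets S" using B by (auto simp: A_def)
  have stay_meas [measurable]: "stay A n \<in> borel_measurable S" for n
    by (rule unit_functionsD(1)[OF stay_unit[OF A]])
  have bound: "AE s in m. \<bar>v s - c\<bar> \<le> e + stay A n s" for n
  proof (induction n)
    case 0
    show ?case
    proof (rule AE_I2)
      fix s assume "s \<in> space m"
      then show "\<bar>v s - c\<bar> \<le> e + stay A 0 s" using v01[of s] c01 e by (auto simp: sp)
    qed
  next
    case (Suc n)
    have "AE s in m. AE t in K s. \<bar>v t - c\<bar> \<le> e + stay A n t"
      by (rule closed[OF _ Suc.IH]) measurable
    with harmonic AE_space show ?case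
    proof eventually_elim
      fix s assume h: "transition v s = v s" and IH: "AE t in K s. \<bar>v t - c\<bar> \<le> e + stay A n t"
        and "s \<in> space m"
      then have s: "s \<in> space S" by (simp add: sp)
      note Ks = kernel_space[OF s]
      interpret Ks: prob_space "K s" using Ks by (simp add: space_prob_algebra)
      note int = integrable_unit_function[OF Ks v] integrable_unit_function[OF Ks stay_unit[OF A]]
      show "\<bar>v s - c\<bar> \<le> e + stay A (Suc n) s"
      proof (cases "s \<in> B i")
        case True
        have "0 \<le> stay A (Suc n) s" by (rule unit_functionsD(2)[OF stay_unit[OF A] s])
        with True show ?thesis by (simp add: B_def c_def)
      next
        case False
        have "v s - c = (\<integral>t. v t - c \<partial>K s)"
          using int by (simp add: h[symmetric] transition_def Ks.prob_space)
        also have "\<bar>\<dots>\<bar> \<le> (\<integral>t. \<bar>v t - c\<bar> \<partial>K s)" by (rule integral_abs_bound)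
        also have "\<dots> \<le> (\<integral>t. e + stay A n t \<partial>K s)"
          by (rule integral_mono_AE[OF _ _ IH]) (use int in auto)
        also have "\<dots> = e + stay A (Suc n) s"
          using False s int by (simp add: stay_Suc transition_def A_def Ks.prob_space)
        finally show ?thesis .
      qed
    qed
  qed
  then have "AE s in m. \<forall>n. \<bar>v s - c\<bar> \<le> e + stay A n s" by (simp add: AE_all_countable)
  with AE_space have "AE s in m. \<bar>v s - c\<bar> \<le> e"
  proof eventually_elim
    fix s assume "s \<in> space m" and le: "\<forall>n. \<bar>v s - c\<bar> \<le> e + stay A n s"
    then have "s \<in> space S" by (simp add: sp)
    then have "(\<lambda>n. stay A n s) \<longlonglongrightarrow> 0"
      unfolding A_def by (intro stay_point_tendsto_0 B visits i)
    from tendsto_add[OF tendsto_const[of e] this] have "(\<lambda>n. e + stay A n s) \<longlonglongrightarrow> e" by simp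
    then show "\<bar>v s - c\<bar> \<le> e" by (rule LIMSEQ_le_const) (use le in auto)
  qed
  then show ?thesis by (rule that)
qed

section \<open>Cesaro convergence in total variation\<close>

text \<open>
  Integrating \<open>h\<close> against the averaged law is integrating the averaged function \<open>u\<close> against the
  initial law, and \<open>u\<close> is harmonic up to \<open>1 / J\<close> because the sum telescopes.
\<close>

lemma transition_cesaro:
  assumes h: "h \<in> unit_functions S" and J: "J > 0"
  defines "u \<equiv> \<lambda>s. (\<Sum>j<J. (transition ^^ j) h s) / real J"
  shows "u \<in> unit_functions S" "s \<in> space S \<Longrightarrow> \<bar>transition u s - u s\<bar> \<le> 1 / real J"
    "lam \<in> space (prob_algebra S) \<Longrightarrow> (\<integral>s. u s \<partial>lam) = (\<Sum>j<J. \<integral>s. h s \<partial>law lam j) / real J"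
proof -
  note Th = transition_power_unit[OF h]
  note [measurable] = unit_functionsD(1)[OF Th]
  show "u \<in> unit_functions S"
  proof (rule unit_functionsI)
    show "u \<in> borel_measurable S" unfolding u_def by measurable
    fix s assume s: "s \<in> space S"
    show "0 \<le> u s" unfolding u_def using unit_functionsD(2)[OF Th s] by (auto intro!: divide_nonneg_nonneg sum_nonneg)
    have "(\<Sum>j<J. (transition ^^ j) h s) \<le> (\<Sum>j<J. 1)"
      by (intro sum_mono unit_functionsD(3)[OF Th s])
    then show "u s \<le> 1" using J by (simp add: u_def)
  qed
  show "\<bar>transition u s - u s\<bar> \<le> 1 / real J" if s: "s \<in> space S"
  proof -
    have "transition u s = (\<Sum>j<J. (transition ^^ Suc j) h s) / real J"
      unfolding u_def transition_def[of "\<lambda>s. (\<Sum>j<J. (transition ^^ j) h s) / real J"]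
      using integrable_unit_function[OF kernel_space[OF s] Th]
      by (simp add: transition_def)
    then have "transition u s - u s = (\<Sum>j<J. (transition ^^ Suc j) h s - (transition ^^ j) h s) / real J"
      by (simp only: u_def sum_subtractf diff_divide_distrib)
    also have "\<dots> = ((transition ^^ J) h s - h s) / real J"
      using sum_lessThan_telescope[of "\<lambda>j. (transition ^^ j) h s" J] by simp
    finally have "\<bar>transition u s - u s\<bar> = \<bar>(transition ^^ J) h s - h s\<bar> / real J" by simp
    also have "\<dots> \<le> 1 / real J"
    proof (intro divide_right_mono)
      show "\<bar>(transition ^^ J) h s - h s\<bar> \<le> 1"
        using unit_functionsD(2,3)[OF Th s, of J] unit_functionsD(2,3)[OF h s] by linarith
    qed simp
    finally show ?thesis .
  qed
  show "(\<integral>s. u s \<partial>lam) = (\<Sum>j<J. \<integral>s. h s \<partial>law lam j) / real J" if lam: "lam \<in> space (prob_algebra S)"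
    unfolding u_def using integrable_unit_function[OF lam Th] by (simp add: integral_law[OF lam h])
qed

lemma law_stationary:
  assumes "stationary_distribution S K p" shows "law p j = p"
  using assms by (induction j) (auto simp: law_Suc stationary_distribution_def)

lemma unit_dominated_convergence:
  assumes \<mu>: "\<mu> \<in> space (prob_algebra S)" and w: "\<And>n::nat. w n \<in> unit_functions S" and v: "v \<in> unit_functions S"
    and lim: "AE s in \<mu>. (\<lambda>n. w n s) \<longlonglongrightarrow> v s"
  shows "(\<lambda>n. \<integral>s. w n s \<partial>\<mu>) \<longlonglongrightarrow> (\<integral>s. v s \<partial>\<mu>)"
proof -
  have sets: "sets \<mu> = sets S" and "prob_space \<mu>" using \<mu> by (auto simp: space_prob_algebra)
  then interpret prob_space \<mu> by simp
  have sp: "space \<mu> = space S" by (rule sets_eq_imp_space_eq[OF sets])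
  show ?thesis
  proof (rule integral_dominated_convergence[where w="\<lambda>_. 1"])
    show "AE s in \<mu>. norm (w n s) \<le> 1" for n
      using unit_functionsD(2,3)[OF w[of n]] by (intro AE_I2) (auto simp: sp)
  qed (use lim integrable_unit_function[OF \<mu> w] integrable_unit_function[OF \<mu> v] in auto)
qed

text \<open>
  A single \<open>J\<close> serves all test functions at once, which is convergence in total variation.  If no
  \<open>J\<close> worked, the averaged test functions would lie in the classes \<open>C n\<close> below, and the limit of a
  sequence selected from them would be a harmonic function that distinguishes \<open>lam\<close> from \<open>p\<close>.
\<close>

lemma cesaro_one_sided:
  assumes harris: "harris_recurrent S K" and p: "stationary_distribution S K p"
    and lam: "lam \<in> space (prob_algebra S)" and e: "e > 0"
  shows "\<exists>J>0. \<forall>h\<in>unit_functions S. (\<Sum>j<J. \<integral>s. h s \<partial>law lam j) / real J - (\<integral>s. h s \<partial>p) \<le> e"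
proof (rule ccontr)
  assume "\<not> ?thesis"
  then have bad: "\<exists>h\<in>unit_functions S. e < (\<Sum>j<J. \<integral>s. h s \<partial>law lam j) / real J - (\<integral>s. h s \<partial>p)"
    if "J > 0" for J using that by (meson not_le)
  have ps: "p \<in> space (prob_algebra S)" and pK: "p \<bind> K = p"
    using p by (auto simp: stationary_distribution_def)
  \<comment> \<open>The selected sequence must converge almost surely at every time, under both initial laws.\<close>
  define \<nu> where "\<nu> i = (case i of 0 \<Rightarrow> p | Suc j \<Rightarrow> law lam j)" for i
  have \<nu>: "\<nu> i \<in> space (prob_algebra S)" for i
    by (auto simp: \<nu>_def ps law_space[OF lam] split: nat.split)
  define m where "m = measure_pmf (geometric_pmf (1 / 2)) \<bind> \<nu>"
  note dom = countable_dominating_prob[where \<nu>=\<nu>, OF \<nu>, folded m_def]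
  note m = dom(1)
  have sets_m: "sets m = sets S" and "prob_space m" using m by (auto simp: space_prob_algebra)
  have [measurable_cong]: "sets m = sets S" by fact
  have closed: "AE s in m. AE t in K s. P t" if P [measurable]: "Measurable.pred S P" and ae: "AE s in m. P s" for P
  proof -
    have K_m: "K \<in> m \<rightarrow>\<^sub>M subprob_algebra S" by measurable
    have \<nu>K: "\<nu> i \<bind> K \<in> space (prob_algebra S)" for i by (rule bind_kernel_space[OF \<nu>])
    have "AE s in \<nu> i \<bind> K. P s" for i
    proof (cases i)
      case 0
      have "\<nu> i \<bind> K = \<nu> 0" using pK by (simp add: 0 \<nu>_def)
      then show ?thesis using ae dom(2)[OF P] by metis
    next
      case (Suc j)
      have "\<nu> i \<bind> K = \<nu> (Suc (Suc j))" by (simp add: Suc \<nu>_def law_Suc)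
      then show ?thesis using ae dom(2)[OF P] by metis
    qed
    then have "AE s in measure_pmf (geometric_pmf (1 / 2)) \<bind> (\<lambda>i. \<nu> i \<bind> K). P s"
      by (simp add: countable_dominating_prob(2)[where \<nu>="\<lambda>i. \<nu> i \<bind> K", OF \<nu>K P])
    then have "AE s in m \<bind> K. P s" by (simp only: dom(3)[OF kernel])
    then show ?thesis by (simp only: AE_bind[OF K_m P])
  qed
  define C where "C n = {v \<in> unit_functions S. (\<forall>s\<in>space S. \<bar>transition v s - v s\<bar> \<le> 1 / real (Suc n)) \<and>
    e \<le> (\<integral>s. v s \<partial>lam) - (\<integral>s. v s \<partial>p)}" for n
  have "\<exists>w. (\<forall>n. w n \<in> C n) \<and> (AE s in m. convergent (\<lambda>n. w n s))"
  proof (rule convergent_selection_midpoint_convex[OF \<open>prob_space m\<close>, of C])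
    show "C n \<subseteq> unit_functions m" for n
      by (auto simp: C_def unit_functions_cong_sets[OF sets_m])
    show "C n \<noteq> {}" for n
    proof -
      from bad[of "Suc n"] obtain h where h: "h \<in> unit_functions S"
        "e < (\<Sum>j<Suc n. \<integral>s. h s \<partial>law lam j) / real (Suc n) - (\<integral>s. h s \<partial>p)" by auto
      note u = transition_cesaro[OF h(1) zero_less_Suc[of n]]
      have "(\<lambda>s. (\<Sum>j<Suc n. (transition ^^ j) h s) / real (Suc n)) \<in> C n"
        unfolding C_def using u(1,2) u(3)[OF lam] u(3)[OF ps] h(2)
        by (simp add: law_stationary[OF p] del: sum.lessThan_Suc of_nat_Suc)
      then show ?thesis by blast
    qed
    show "decseq C"
    proof (rule decseq_SucI)
      fix n
      have "1 / real (Suc (Suc n)) \<le> 1 / real (Suc n)" by (simp add: field_simps)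
      then show "C (Suc n) \<subseteq> C n" unfolding C_def by fastforce
    qed
    show "(\<lambda>s. (g s + h s) / 2) \<in> C n" if "g \<in> C n" "h \<in> C n" for n g h
    proof -
      have g: "g \<in> unit_functions S" and h: "h \<in> unit_functions S" using that by (auto simp: C_def)
      note [measurable] = unit_functionsD(1)[OF g] unit_functionsD(1)[OF h]
      have avg: "(\<integral>s. (g s + h s) / 2 \<partial>\<mu>) = ((\<integral>s. g s \<partial>\<mu>) + (\<integral>s. h s \<partial>\<mu>)) / 2"
        if "\<mu> \<in> space (prob_algebra S)" for \<mu>
        using integrable_unit_function[OF that g] integrable_unit_function[OF that h] by simp
      have "(\<lambda>s. (g s + h s) / 2) \<in> unit_functions S"
      proof (rule unit_functionsI)
        fix s assume "s \<in> space S"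
        then show "0 \<le> (g s + h s) / 2" "(g s + h s) / 2 \<le> 1"
          using unit_functionsD(2,3)[OF g, of s] unit_functionsD(2,3)[OF h, of s] by auto
      qed measurable
      moreover have "\<bar>transition (\<lambda>s. (g s + h s) / 2) s - (g s + h s) / 2\<bar> \<le> 1 / real (Suc n)"
        if s: "s \<in> space S" for s
      proof -
        have mid: "\<bar>(x + y) / 2\<bar> \<le> r" if "\<bar>x\<bar> \<le> r" "\<bar>y\<bar> \<le> r" for x y r :: real
          using that by (auto simp: abs_le_iff field_simps)
        have "transition (\<lambda>s. (g s + h s) / 2) s - (g s + h s) / 2
          = ((transition g s - g s) + (transition h s - h s)) / 2"
          using avg[OF kernel_space[OF s]] by (simp add: transition_def field_simps)
        moreover have "\<bar>transition g s - g s\<bar> \<le> 1 / real (Suc n)" "\<bar>transition h s - h s\<bar> \<le> 1 / real (Suc n)"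
          using \<open>g \<in> C n\<close> \<open>h \<in> C n\<close> s by (auto simp: C_def)
        ultimately show ?thesis by (simp only: mid)
      qed
      moreover have "e \<le> (\<integral>s. (g s + h s) / 2 \<partial>lam) - (\<integral>s. (g s + h s) / 2 \<partial>p)"
      proof -
        have "e \<le> (\<integral>s. g s \<partial>lam) - (\<integral>s. g s \<partial>p)" "e \<le> (\<integral>s. h s \<partial>lam) - (\<integral>s. h s \<partial>p)"
          using \<open>g \<in> C n\<close> \<open>h \<in> C n\<close> by (auto simp: C_def)
        then show ?thesis unfolding avg[OF lam] avg[OF ps] by (simp add: field_simps)
      qed
      ultimately show ?thesis by (auto simp: C_def)
    qed
  qed
  then obtain w where w: "\<And>n. w n \<in> C n" and conv: "AE s in m. convergent (\<lambda>n. w n s)" by blast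
  have wu: "w n \<in> unit_functions S" for n using w by (auto simp: C_def)
  have w_meas [measurable]: "w n \<in> borel_measurable S" for n by (rule unit_functionsD(1)[OF wu])
  \<comment> \<open>Truncation keeps \<open>v\<close> in the unit interval where the sequence diverges.\<close>
  define v where "v s = max 0 (min 1 (lim (\<lambda>n. w n s)))" for s
  have v_meas [measurable]: "v \<in> borel_measurable S" unfolding v_def by measurable
  have v: "v \<in> unit_functions S" by (rule unit_functionsI) (auto simp: v_def)
  have v_lim: "(\<lambda>n. w n s) \<longlonglongrightarrow> v s" if "convergent (\<lambda>n. w n s)" "s \<in> space S" for s
  proof -
    have l: "(\<lambda>n. w n s) \<longlonglongrightarrow> lim (\<lambda>n. w n s)" using that(1) by (simp add: convergent_LIMSEQ_iff)
    have "0 \<le> lim (\<lambda>n. w n s)" "lim (\<lambda>n. w n s) \<le> 1"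
      using unit_functionsD(2,3)[OF wu that(2)]
      by (auto intro: LIMSEQ_le_const[OF l] LIMSEQ_le_const2[OF l])
    with l show ?thesis by (simp add: v_def)
  qed
  have sp: "space m = space S" by (rule sets_eq_imp_space_eq[OF sets_m])
  have ae_lim: "AE s in m. (\<lambda>n. w n s) \<longlonglongrightarrow> v s"
    using conv AE_space by eventually_elim (auto simp: sp v_lim)
  have pred_lim: "Measurable.pred S (\<lambda>s. (\<lambda>n. w n s) \<longlonglongrightarrow> v s)" by measurable
  have "AE s in m. AE t in K s. (\<lambda>n. w n t) \<longlonglongrightarrow> v t"
    by (rule closed[OF pred_lim ae_lim])
  with ae_lim AE_space have harm: "AE s in m. transition v s = v s"
  proof eventually_elim
    fix s assume lim: "(\<lambda>n. w n s) \<longlonglongrightarrow> v s" and K_lim: "AE t in K s. (\<lambda>n. w n t) \<longlonglongrightarrow> v t"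
      and "s \<in> space m"
    then have s: "s \<in> space S" by (simp add: sp)
    have "(\<lambda>n. transition (w n) s) \<longlonglongrightarrow> transition v s"
      unfolding transition_def by (rule unit_dominated_convergence[OF kernel_space[OF s] wu v K_lim])
    then have "(\<lambda>n. transition (w n) s - w n s) \<longlonglongrightarrow> transition v s - v s"
      by (intro tendsto_diff lim)
    moreover have "(\<lambda>n. transition (w n) s - w n s) \<longlonglongrightarrow> 0"
    proof (rule Lim_null_comparison)
      show "\<forall>\<^sub>F n in sequentially. norm (transition (w n) s - w n s) \<le> inverse (real (Suc n))"
        using w s by (auto simp: C_def inverse_eq_divide)
    qed (rule LIMSEQ_inverse_real_of_nat)
    ultimately show "transition v s = v s" using LIMSEQ_unique by fastforce
  qed
  obtain c where c: "AE s in m. \<bar>v s - c\<bar> \<le> e / 3"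
    by (rule almost_harmonic_nearly_constant[OF m closed harris v harm, of "e / 3"]) (use e in auto)
  have sub: "(AE s in lam. P s) \<and> (AE s in p. P s)" if P: "Measurable.pred S P" "AE s in m. P s" for P
  proof -
    have "AE s in \<nu> 0. P s" "AE s in \<nu> (Suc 0). P s" using P dom(2)[OF P(1)] by blast+
    moreover have "\<nu> 0 = p" "\<nu> (Suc 0) = lam" by (simp_all add: \<nu>_def)
    ultimately show ?thesis by metis
  qed
  have "(\<lambda>n. (\<integral>s. w n s \<partial>lam) - (\<integral>s. w n s \<partial>p)) \<longlonglongrightarrow> (\<integral>s. v s \<partial>lam) - (\<integral>s. v s \<partial>p)"
    using sub[OF pred_lim ae_lim]
    by (intro tendsto_diff unit_dominated_convergence[OF lam wu v] unit_dominated_convergence[OF ps wu v]) auto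
  then have gap: "e \<le> (\<integral>s. v s \<partial>lam) - (\<integral>s. v s \<partial>p)"
    by (rule LIMSEQ_le_const) (use w in \<open>auto simp: C_def\<close>)
  have "AE s in m. v s \<le> c + e / 3" "AE s in m. c - e / 3 \<le> v s"
    by (rule AE_mp[OF c], intro AE_I2 impI, linarith)+
  with sub[of "\<lambda>s. v s \<le> c + e / 3"] sub[of "\<lambda>s. c - e / 3 \<le> v s"]
  have le: "AE s in lam. v s \<le> c + e / 3" "AE s in p. c - e / 3 \<le> v s" by auto
  interpret lam: prob_space lam using lam by (simp add: space_prob_algebra)
  interpret p: prob_space p using ps by (simp add: space_prob_algebra)
  have "(\<integral>s. v s \<partial>lam) \<le> c + e / 3"
    by (rule lam.integral_le_const[OF integrable_unit_function[OF lam v] le(1)])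
  moreover have "c - e / 3 \<le> (\<integral>s. v s \<partial>p)"
    by (rule p.integral_ge_const[OF integrable_unit_function[OF ps v] le(2)])
  ultimately show False using gap e by linarith
qed

text \<open>
  Complementing the test function turns the one-sided bound into a two-sided one.
\<close>

lemma cesaro_total_variation:
  assumes harris: "harris_recurrent S K" and p: "stationary_distribution S K p"
    and lam: "lam \<in> space (prob_algebra S)" and e: "e > 0"
  obtains J where "J > 0"
    "\<And>h. h \<in> unit_functions S \<Longrightarrow> \<bar>(\<Sum>j<J. \<integral>s. h s \<partial>law lam j) / real J - (\<integral>s. h s \<partial>p)\<bar> \<le> e"
proof -
  have ps: "p \<in> space (prob_algebra S)" using p by (simp add: stationary_distribution_def)
  obtain J where J: "J > 0"
    and le: "\<And>h. h \<in> unit_functions S \<Longrightarrow> (\<Sum>j<J. \<integral>s. h s \<partial>law lam j) / real J - (\<integral>s. h s \<partial>p) \<le> e"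
    using cesaro_one_sided[OF assms] by blast
  have "\<bar>(\<Sum>j<J. \<integral>s. h s \<partial>law lam j) / real J - (\<integral>s. h s \<partial>p)\<bar> \<le> e" if h: "h \<in> unit_functions S" for h
  proof -
    have u: "(\<lambda>s. 1 - h s) \<in> unit_functions S"
      using unit_functionsD[OF h] by (intro unit_functionsI) auto
    have compl: "(\<integral>s. 1 - h s \<partial>\<mu>) = 1 - (\<integral>s. h s \<partial>\<mu>)" if \<mu>: "\<mu> \<in> space (prob_algebra S)" for \<mu>
    proof -
      interpret prob_space \<mu> using \<mu> by (simp add: space_prob_algebra)
      show ?thesis using integrable_unit_function[OF \<mu> h] by (simp add: prob_space)
    qed
    have "(\<Sum>j<J. \<integral>s. 1 - h s \<partial>law lam j) / real J = 1 - (\<Sum>j<J. \<integral>s. h s \<partial>law lam j) / real J"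
      using J by (simp add: compl[OF law_space[OF lam]] sum_subtractf diff_divide_distrib)
    with le[OF u] le[OF h] show ?thesis by (simp add: compl[OF ps])
  qed
  with J show ?thesis by (rule that)
qed

end

section \<open>Phantom distribution functions and sandwiches\<close>

text \<open>
  \<open>t\<^sup>n (1 - t\<^sup>J) \<le> J t\<^sup>n (1 - t)\<close>, and \<open>(n + 1) t\<^sup>n (1 - t) \<le> 1\<close> because \<open>t\<^sup>n\<close> is the smallest term of
  a geometric sum.  The bound does not depend on \<open>t\<close>.
\<close>

lemma power_shift_gap:
  fixes t :: real
  assumes "0 \<le> t" "t \<le> 1"
  shows "t ^ n - t ^ (n + J) \<le> real J / real (Suc n)"
proof -
  have "1 + real J * (t - 1) \<le> (1 + (t - 1)) ^ J"
    by (rule Bernoulli_inequality) (use assms in auto)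
  then have "1 - t ^ J \<le> real J * (1 - t)" by (simp add: algebra_simps)
  then have "t ^ n * (1 - t ^ J) \<le> t ^ n * (real J * (1 - t))"
    using assms by (intro mult_left_mono) auto
  moreover have "real (Suc n) * (t ^ n * (1 - t)) \<le> 1"
  proof -
    have "real (Suc n) * t ^ n = (\<Sum>i<Suc n. t ^ n)" by simp
    also have "\<dots> \<le> (\<Sum>i<Suc n. t ^ i)"
      by (intro sum_mono power_decreasing) (use assms in auto)
    finally have "real (Suc n) * t ^ n * (1 - t) \<le> (\<Sum>i<Suc n. t ^ i) * (1 - t)"
      using assms by (intro mult_right_mono) auto
    also have "\<dots> = 1 - t ^ Suc n"
      by (simp only: one_diff_power_eq[of t "Suc n"] mult.commute)
    also have "\<dots> \<le> 1" using assms by simp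
    finally show ?thesis by (simp add: mult.assoc)
  qed
  then have "t ^ n * (1 - t) \<le> 1 / real (Suc n)"
    by (simp add: pos_le_divide_eq mult.commute del: of_nat_Suc)
  then have "real J * (t ^ n * (1 - t)) \<le> real J * (1 / real (Suc n))"
    by (intro mult_left_mono) auto
  ultimately show ?thesis by (simp add: power_add algebra_simps del: of_nat_Suc)
qed

lemma distribution_function_bounds:
  assumes "distribution_function G"
  shows "0 \<le> G x" "G x \<le> 1" "mono G"
proof -
  from assms obtain \<mu> where \<mu>: "real_distribution \<mu>" "G = cdf \<mu>"
    by (auto simp: distribution_function_def)
  interpret real_distribution \<mu> by fact
  show "0 \<le> G x" "G x \<le> 1" "mono G"
    by (auto simp: \<mu>(2) cdf_nonneg cdf_bounded_prob intro!: monoI cdf_nondecreasing)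
qed

lemma continuous_distribution_function_attains:
  assumes "distribution_function G" and cont: "continuous_on UNIV G" and t: "0 < t" "t < 1"
  obtains x where "G x = t"
proof -
  from assms obtain \<mu> where \<mu>: "real_distribution \<mu>" "G = cdf \<mu>"
    by (auto simp: distribution_function_def)
  interpret real_distribution \<mu> by fact
  have "eventually (\<lambda>x. G x < t) at_bot"
    using order_tendstoD(2)[OF cdf_lim_at_bot t(1)] by (simp add: \<mu>(2))
  then obtain a where a: "\<And>x. x \<le> a \<Longrightarrow> G x < t" by (auto simp: eventually_at_bot_linorder)
  have "eventually (\<lambda>x. t < G x) at_top"
    using order_tendstoD(1)[OF cdf_lim_at_top_prob t(2)] by (simp add: \<mu>(2))
  then obtain b where b: "\<And>x. b \<le> x \<Longrightarrow> t < G x" by (auto simp: eventually_at_top_linorder)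
  have "\<exists>x\<ge>min a b. x \<le> max a b \<and> G x = t"
    by (rule IVT') (use a[of "min a b"] b[of "max a b"] continuous_on_subset[OF cont] in auto)
  then show ?thesis using that by blast
qed

definition uniformly_phantom :: "(nat \<Rightarrow> real \<Rightarrow> real) \<Rightarrow> (real \<Rightarrow> real) \<Rightarrow> bool"
  where "uniformly_phantom F G \<longleftrightarrow> (\<forall>e>0. \<exists>N. \<forall>n\<ge>N. \<forall>x. \<bar>F n x - G x ^ n\<bar> \<le> e)"

lemma uniformly_phantomD:
  assumes "uniformly_phantom F G" "e > 0"
  obtains N where "\<And>n x. n \<ge> N \<Longrightarrow> \<bar>F n x - G x ^ n\<bar> \<le> e"
  using assms unfolding uniformly_phantom_def by blast

text \<open>
  Every initial segment keeps its maximum, up to probability \<open>e\<close>, below some level that \<open>G\<close> has not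
  exhausted.  This rules out that finitely many observations dominate the scale described by \<open>G\<close>.
\<close>

definition uniform_tail :: "(nat \<Rightarrow> real \<Rightarrow> real) \<Rightarrow> (real \<Rightarrow> real) \<Rightarrow> bool"
  where "uniform_tail F G \<longleftrightarrow> (\<forall>J. \<forall>e>0. \<exists>x. G x < 1 \<and> 1 - F J x \<le> e)"

text \<open>
  A level \<open>x\<close> at which \<open>G\<^sup>n\<close> is close to, but below, \<open>1\<close> controls the maximum of \<open>n\<close> and hence of \<open>J \<le> n\<close>
  observations.  Such a level exists since a continuous \<open>G\<close> takes every value in \<open>(0, 1)\<close>.
\<close>

lemma phantom_imp_tail:
  assumes ph: "uniformly_phantom F G" and G: "distribution_function G" "continuous_on UNIV G"
    and dec: "\<And>m n x. m \<le> n \<Longrightarrow> F n x \<le> F m x"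
  shows "uniform_tail F G"
  unfolding uniform_tail_def
proof (intro allI impI)
  fix J :: nat and e :: real assume e: "e > 0"
  obtain N where N: "\<And>n x. n \<ge> N \<Longrightarrow> \<bar>F n x - G x ^ n\<bar> \<le> e / 2"
    using uniformly_phantomD[OF ph, of "e / 2"] e by auto
  define n where "n = Suc (max N J)"
  \<comment> \<open>By Bernoulli, \<open>(1 - d)\<^sup>n \<ge> 1 - n d \<ge> 1 - e / 2\<close>.\<close>
  define d where "d = min (1 / 2) (e / (2 * real n))"
  have n: "real n > 0" by (simp add: n_def)
  have d: "0 < d" "d \<le> 1 / 2" "d \<le> e / (2 * real n)"
    using e n by (auto simp: d_def)
  then have nd: "real n * d \<le> e / 2" using n by (simp add: field_simps)
  obtain x where x: "G x = 1 - d"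
    using continuous_distribution_function_attains[OF G, of "1 - d"] d by auto
  have "1 + real n * (- d) \<le> (1 + (- d)) ^ n"
    by (rule Bernoulli_inequality) (use d in auto)
  then have "1 - e / 2 \<le> G x ^ n" using nd x by simp
  moreover have "\<bar>F n x - G x ^ n\<bar> \<le> e / 2" by (rule N) (simp add: n_def)
  moreover have "F n x \<le> F J x" by (rule dec) (simp add: n_def)
  ultimately have "1 - F J x \<le> e" by linarith
  then show "\<exists>x. G x < 1 \<and> 1 - F J x \<le> e" using d x by (intro exI[of _ x]) auto
qed

text \<open>
  Let \<open>x0\<close> be a level from the tail condition.  For \<open>x \<ge> x0\<close> the sandwich holds with errors of order
  \<open>e\<close> and a shift by \<open>J\<close>, which is negligible for powers of \<open>G\<close>.  For \<open>x \<le> x0\<close>, \<open>G x ^ n\<close> is at most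
  \<open>G x0 ^ n\<close>, which tends to \<open>0\<close>; by monotonicity the upper bound for \<open>H\<close> at \<open>x0\<close> carries over to
  \<open>x\<close>, while the lower bound for \<open>F\<close> becomes trivial.
\<close>

lemma sandwich_phantom_iff:
  assumes G: "distribution_function G"
    and tail: "uniform_tail F G"
    and F_mono: "\<And>n x y. x \<le> y \<Longrightarrow> F n x \<le> F n y" and F_nonneg: "\<And>n x. 0 \<le> F n x"
    and H_mono: "\<And>n x y. x \<le> y \<Longrightarrow> H n x \<le> H n y"
    and sandwich: "\<And>e. e > 0 \<Longrightarrow>
      \<exists>J. \<forall>n x. F (n + J) x - e \<le> H n x \<and> H n x \<le> F n x + (1 - F J x) + e"
  shows "uniformly_phantom F G \<longleftrightarrow> uniformly_phantom H G"
proof -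
  note Gb = distribution_function_bounds[OF G]
  have thresholds: "\<exists>J x0 N. (\<forall>n x. F (n + J) x - e \<le> H n x \<and> H n x \<le> F n x + (1 - F J x) + e)
      \<and> (\<forall>x\<ge>x0. 1 - F J x \<le> e) \<and> (\<forall>n\<ge>N. \<forall>x\<le>x0. G x ^ n \<le> e)
      \<and> (\<forall>n\<ge>N. \<forall>x. G x ^ n - G x ^ (n + J) \<le> e)" if e: "e > 0" for e
  proof -
    obtain J where J: "\<And>n x. F (n + J) x - e \<le> H n x \<and> H n x \<le> F n x + (1 - F J x) + e"
      using sandwich[OF e] by blast
    obtain x0 where x0: "G x0 < 1" "1 - F J x0 \<le> e"
      using tail e unfolding uniform_tail_def by blast
    have "eventually (\<lambda>n. G x0 ^ n < e) sequentially"
      using order_tendstoD(2)[OF LIMSEQ_power_zero[of "G x0"] e] x0(1) Gb(1)[of x0] by simp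
    moreover have "(\<lambda>n. real J * inverse (real (Suc n))) \<longlonglongrightarrow> real J * 0"
      by (intro tendsto_mult tendsto_const LIMSEQ_inverse_real_of_nat)
    then have "eventually (\<lambda>n. real J / real (Suc n) < e) sequentially"
      using order_tendstoD(2)[of _ 0 _ e] e by (simp add: divide_inverse)
    ultimately have "eventually (\<lambda>n. G x0 ^ n < e \<and> real J / real (Suc n) < e) sequentially"
      by eventually_elim auto
    then obtain N where N: "\<And>n. n \<ge> N \<Longrightarrow> G x0 ^ n < e \<and> real J / real (Suc n) < e"
      by (auto simp: eventually_sequentially)
    have "1 - F J x \<le> e" if "x \<ge> x0" for x using F_mono[OF that, of J] x0(2) by linarith
    moreover have "G x ^ n \<le> e" if "n \<ge> N" "x \<le> x0" for n x
      using power_mono[OF monoD[OF Gb(3) that(2)] Gb(1), of n] N[OF that(1)] by linarith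
    moreover have "G x ^ n - G x ^ (n + J) \<le> e" if "n \<ge> N" for n x
      using power_shift_gap[OF Gb(1,2), of x n J] N[OF that] by linarith
    ultimately show ?thesis using J by blast
  qed
  show ?thesis
  proof
    assume ph: "uniformly_phantom F G"
    show "uniformly_phantom H G"
      unfolding uniformly_phantom_def
    proof (intro allI impI)
      fix e :: real assume "e > 0"
      \<comment> \<open>Up to four errors of size \<open>d\<close> accumulate: sandwich, tail, phantom, and shift or small power.\<close>
      define d where "d = e / 4"
      have d: "d > 0" using \<open>e > 0\<close> by (simp add: d_def)
      obtain J x0 N where J: "\<And>n x. F (n + J) x - d \<le> H n x" "\<And>n x. H n x \<le> F n x + (1 - F J x) + d"
        and x0: "\<And>x. x0 \<le> x \<Longrightarrow> 1 - F J x \<le> d" and N: "\<And>n x. N \<le> n \<Longrightarrow> x \<le> x0 \<Longrightarrow> G x ^ n \<le> d"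
        and shift: "\<And>n x. N \<le> n \<Longrightarrow> G x ^ n - G x ^ (n + J) \<le> d"
        using thresholds[OF d] by blast
      obtain N' where N': "\<And>n x. n \<ge> N' \<Longrightarrow> \<bar>F n x - G x ^ n\<bar> \<le> d"
        using uniformly_phantomD[OF ph d] by blast
      have "\<bar>H n x - G x ^ n\<bar> \<le> e" if n: "n \<ge> max N N'" for n x
      proof -
        have upper: "H n y \<le> G y ^ n + 3 * d" if "y \<ge> x0" for y
          using J(2)[of n y] x0[OF that] N'[of n y] n by linarith
        have "H n x \<le> G x ^ n + 4 * d"
        proof (cases "x0 \<le> x")
          case True
          then show ?thesis using upper[of x] d by linarith
        next
          case False
          then have "H n x \<le> H n x0" by (intro H_mono) auto
          then show ?thesis
            using upper[of x0] N[of n x0] n zero_le_power[OF Gb(1)[of x], of n] by auto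
        qed
        moreover have "G x ^ n - 3 * d \<le> H n x"
          using J(1)[of n x] N'[of "n + J" x] shift[of n x] n by auto
        ultimately show ?thesis using d unfolding d_def by linarith
      qed
      then show "\<exists>N. \<forall>n\<ge>N. \<forall>x. \<bar>H n x - G x ^ n\<bar> \<le> e" by blast
    qed
  next
    assume ph: "uniformly_phantom H G"
    show "uniformly_phantom F G"
      unfolding uniformly_phantom_def
    proof (intro allI impI)
      fix e :: real assume "e > 0"
      \<comment> \<open>Up to four errors of size \<open>d\<close> accumulate: sandwich, tail, phantom, and shift or small power.\<close>
      define d where "d = e / 4"
      have d: "d > 0" using \<open>e > 0\<close> by (simp add: d_def)
      obtain J x0 N where J: "\<And>n x. F (n + J) x - d \<le> H n x" "\<And>n x. H n x \<le> F n x + (1 - F J x) + d"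
        and x0: "\<And>x. x0 \<le> x \<Longrightarrow> 1 - F J x \<le> d" and N: "\<And>n x. N \<le> n \<Longrightarrow> x \<le> x0 \<Longrightarrow> G x ^ n \<le> d"
        and shift: "\<And>n x. N \<le> n \<Longrightarrow> G x ^ n - G x ^ (n + J) \<le> d"
        using thresholds[OF d] by blast
      obtain N' where N': "\<And>n x. n \<ge> N' \<Longrightarrow> \<bar>H n x - G x ^ n\<bar> \<le> d"
        using uniformly_phantomD[OF ph d] by blast
      have "\<bar>F n x - G x ^ n\<bar> \<le> e" if n: "n \<ge> max N N' + J" for n x
      proof -
        define k where "k = n - J"
        have k: "n = k + J" "k \<ge> N" "k \<ge> N'" using n by (auto simp: k_def)
        have "F n x \<le> G x ^ n + 3 * d"
          using J(1)[of k x] N'[OF k(3), of x] shift[OF k(2), of x] by (auto simp: k(1))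
        moreover have "G x ^ n - 3 * d \<le> F n x"
        proof (cases "x0 \<le> x")
          case True
          have "\<bar>H n x - G x ^ n\<bar> \<le> d" by (rule N') (use n in simp)
          then show ?thesis using J(2)[of n x] x0[OF True] by linarith
        next
          case False
          then have "G x ^ n \<le> d" by (intro N) (use n in auto)
          then show ?thesis using F_nonneg[of n x] d by linarith
        qed
        ultimately show ?thesis using d unfolding d_def by linarith
      qed
      then show "\<exists>N. \<forall>n\<ge>N. \<forall>x. \<bar>F n x - G x ^ n\<bar> \<le> e" by blast
    qed
  qed
qed

lemma SUP_tendsto_0_iff:
  fixes D :: "nat \<Rightarrow> real \<Rightarrow> real"
  assumes bound: "\<And>n x. n > 0 \<Longrightarrow> \<bar>D n x\<bar> \<le> 1"
  shows "(\<lambda>n. SUP x. \<bar>D n x\<bar>) \<longlonglongrightarrow> 0 \<longleftrightarrow> (\<forall>e>0. \<exists>N. \<forall>n\<ge>N. \<forall>x. \<bar>D n x\<bar> \<le> e)"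
proof -
  have bdd: "bdd_above (range (\<lambda>x. \<bar>D n x\<bar>))" if "n > 0" for n
    by (rule bdd_aboveI[of _ 1]) (use bound[OF that] in auto)
  have upper: "\<bar>D n x\<bar> \<le> (SUP x. \<bar>D n x\<bar>)" if "n > 0" for n x
    by (rule cSUP_upper[OF _ bdd[OF that]]) simp
  have nonneg: "0 \<le> (SUP x. \<bar>D n x\<bar>)" if "n > 0" for n
    using upper[OF that, of 0] by (rule order_trans[OF abs_ge_zero])
  show ?thesis
  proof (intro iffI allI impI)
    fix e :: real assume lim: "(\<lambda>n. SUP x. \<bar>D n x\<bar>) \<longlonglongrightarrow> 0" and "e > 0"
    then have "eventually (\<lambda>n. (SUP x. \<bar>D n x\<bar>) < e) sequentially" by (intro order_tendstoD(2))
    then obtain N where N: "\<And>n. n \<ge> N \<Longrightarrow> (SUP x. \<bar>D n x\<bar>) < e" by (auto simp: eventually_sequentially)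
    have "\<bar>D n x\<bar> \<le> e" if "n \<ge> Suc N" for n x
      using upper[of n x] N[of n] that by auto
    then show "\<exists>N. \<forall>n\<ge>N. \<forall>x. \<bar>D n x\<bar> \<le> e" by blast
  next
    assume unif: "\<forall>e>0. \<exists>N. \<forall>n\<ge>N. \<forall>x. \<bar>D n x\<bar> \<le> e"
    show "(\<lambda>n. SUP x. \<bar>D n x\<bar>) \<longlonglongrightarrow> 0"
    proof (rule LIMSEQ_I)
      fix r :: real assume r: "r > 0"
      with unif obtain N where N: "\<And>n x. n \<ge> N \<Longrightarrow> \<bar>D n x\<bar> \<le> r / 2" by (metis half_gt_zero)
      have "norm ((SUP x. \<bar>D n x\<bar>) - 0) < r" if "n \<ge> Suc N" for n
      proof -
        have "(SUP x. \<bar>D n x\<bar>) \<le> r / 2" using N[of n] that by (intro cSUP_least) auto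
        then show ?thesis using nonneg[of n] that r by auto
      qed
      then show "\<exists>no. \<forall>n\<ge>no. norm ((SUP x. \<bar>D n x\<bar>) - 0) < r" by blast
    qed
  qed
qed

section \<open>Maxima along the chain\<close>

context markov_kernel
begin

text \<open>
  The distribution function of the partial maximum, expressed through the window event so that the
  empty maximum at \<open>n = 0\<close> gets the value \<open>1\<close>, which keeps the family decreasing in \<open>n\<close>.
\<close>

definition max_cdf :: "('a \<Rightarrow> real) \<Rightarrow> 'a measure \<Rightarrow> nat \<Rightarrow> real \<Rightarrow> real"
  where "max_cdf f lam n x = measure (chain_law S K lam)
    {\<omega> \<in> space (chain_law S K lam). \<forall>i<n. \<omega> i \<in> {s \<in> space S. f s \<le> x}}"

lemma sublevel_measurable:
  fixes f :: "'a \<Rightarrow> real"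
  assumes [measurable]: "f \<in> borel_measurable S"
  shows "{s \<in> space S. f s \<le> x} \<in> sets S"
  by measurable

lemma max_cdf_measurable:
  fixes f :: "'a \<Rightarrow> real"
  assumes f: "f \<in> borel_measurable S" and lam: "lam \<in> space (prob_algebra S)"
  shows "{\<omega> \<in> space (chain_law S K lam). \<forall>i<n. \<omega> i \<in> {s \<in> space S. f s \<le> x}} \<in> sets (chain_law S K lam)"
  by (rule window_measurable[OF lam sublevel_measurable[OF f], of n 0, unfolded add_0])

lemma max_cdf_bounds:
  assumes f: "f \<in> borel_measurable S" and lam: "lam \<in> space (prob_algebra S)"
  shows "0 \<le> max_cdf f lam n x" "max_cdf f lam n x \<le> 1"
    "x \<le> y \<Longrightarrow> max_cdf f lam n x \<le> max_cdf f lam n y"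
    "m \<le> n \<Longrightarrow> max_cdf f lam n x \<le> max_cdf f lam m x"
proof -
  interpret P: prob_space "chain_law S K lam" by (rule prob_space_chain_law[OF kernel lam])
  note meas = max_cdf_measurable[OF f lam]
  show "0 \<le> max_cdf f lam n x" "max_cdf f lam n x \<le> 1" by (auto simp: max_cdf_def)
  show "x \<le> y \<Longrightarrow> max_cdf f lam n x \<le> max_cdf f lam n y"
    unfolding max_cdf_def by (rule P.finite_measure_mono[OF _ meas]) (auto intro: order_trans)
  show "m \<le> n \<Longrightarrow> max_cdf f lam n x \<le> max_cdf f lam m x"
    unfolding max_cdf_def by (rule P.finite_measure_mono[OF _ meas]) auto
qed

text \<open>
  The value of \<open>partial_max\<close> at \<open>n = 0\<close> is unspecified, so the two families are compared from
  \<open>n = 1\<close> on.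
\<close>

lemma continuous_phantom_iff:
  assumes f: "f \<in> borel_measurable S" and lam: "lam \<in> space (prob_algebra S)"
    and X: "\<And>n \<omega>. X n \<omega> = f (\<omega> n)"
  shows "continuous_phantom (chain_law S K lam) X G \<longleftrightarrow>
    distribution_function G \<and> continuous_on UNIV G \<and> uniformly_phantom (max_cdf f lam) G"
proof (cases "distribution_function G")
  case True
  let ?P = "chain_law S K lam"
  define D where "D n x = measure ?P {\<omega> \<in> space ?P. partial_max X n \<omega> \<le> x} - G x ^ n" for n x
  note Gb = distribution_function_bounds[OF True]
  have D: "D n x = max_cdf f lam n x - G x ^ n" if "n > 0" for n x
  proof -
    have "partial_max X n \<omega> \<le> x \<longleftrightarrow> (\<forall>i<n. f (\<omega> i) \<le> x)" for \<omega>
      unfolding partial_max_def X by (subst Max_le_iff) (use that in auto)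
    then have "{\<omega> \<in> space ?P. partial_max X n \<omega> \<le> x}
        = {\<omega> \<in> space ?P. \<forall>i<n. \<omega> i \<in> {s \<in> space S. f s \<le> x}}"
      using measurable_space[OF coordinate_measurable[OF lam]] by auto
    then show ?thesis by (simp add: D_def max_cdf_def)
  qed
  have "\<bar>D n x\<bar> \<le> 1" if "n > 0" for n x
    using D[OF that, of x] max_cdf_bounds(1,2)[OF f lam, of n x]
      zero_le_power[OF Gb(1), of x n] power_le_one[OF Gb(1,2), of x n] by linarith
  then have "(\<lambda>n. SUP x. \<bar>D n x\<bar>) \<longlonglongrightarrow> 0 \<longleftrightarrow> (\<forall>e>0. \<exists>N. \<forall>n\<ge>N. \<forall>x. \<bar>D n x\<bar> \<le> e)"
    by (rule SUP_tendsto_0_iff)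
  also have "\<dots> \<longleftrightarrow> uniformly_phantom (max_cdf f lam) G"
    unfolding uniformly_phantom_def
  proof (intro all_cong1 imp_cong refl iffI)
    fix e :: real
    assume "\<exists>N. \<forall>n\<ge>N. \<forall>x. \<bar>D n x\<bar> \<le> e"
    then obtain N where N: "\<forall>n\<ge>N. \<forall>x. \<bar>D n x\<bar> \<le> e" ..
    then show "\<exists>N. \<forall>n\<ge>N. \<forall>x. \<bar>max_cdf f lam n x - G x ^ n\<bar> \<le> e"
      by (intro exI[of _ "Suc N"]) (auto simp: D[symmetric])
  next
    fix e :: real
    assume "\<exists>N. \<forall>n\<ge>N. \<forall>x. \<bar>max_cdf f lam n x - G x ^ n\<bar> \<le> e"
    then obtain N where N: "\<forall>n\<ge>N. \<forall>x. \<bar>max_cdf f lam n x - G x ^ n\<bar> \<le> e" ..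
    then show "\<exists>N. \<forall>n\<ge>N. \<forall>x. \<bar>D n x\<bar> \<le> e"
      by (intro exI[of _ "Suc N"]) (auto simp: D)
  qed
  finally show ?thesis
    using True by (auto simp: continuous_phantom_def phantom_distribution_function_def D_def)
qed (auto simp: continuous_phantom_def phantom_distribution_function_def)

text \<open>
  The total variation theorem is applied to the function \<open>s \<mapsto> P\<^sub>s(max \<le> x)\<close>: its integral against
  \<open>law lam j\<close> is the probability that the maximum over the window \<open>[j, j + n)\<close> is at most \<open>x\<close>, and
  for all \<open>j < J\<close> this lies between the same two bounds, hence so does the average.
\<close>

lemma max_cdf_sandwich:
  assumes harris: "harris_recurrent S K" and p: "stationary_distribution S K p"
    and f: "f \<in> borel_measurable S" and lam: "lam \<in> space (prob_algebra S)" and e: "e > 0"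
  shows "\<exists>J. \<forall>n x. max_cdf f lam (n + J) x - e \<le> max_cdf f p n x \<and>
    max_cdf f p n x \<le> max_cdf f lam n x + (1 - max_cdf f lam J x) + e"
proof -
  let ?P = "chain_law S K lam"
  interpret P: prob_space ?P by (rule prob_space_chain_law[OF kernel lam])
  have ps: "p \<in> space (prob_algebra S)" using p by (simp add: stationary_distribution_def)
  obtain J where J: "J > 0"
    and tv: "\<And>h. h \<in> unit_functions S \<Longrightarrow> \<bar>(\<Sum>j<J. \<integral>s. h s \<partial>law lam j) / real J - (\<integral>s. h s \<partial>p)\<bar> \<le> e"
    using cesaro_total_variation[OF harris p lam e] by blast
  have "max_cdf f lam (n + J) x - e \<le> max_cdf f p n x \<and>
    max_cdf f p n x \<le> max_cdf f lam n x + (1 - max_cdf f lam J x) + e" for n x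
  proof -
    define A where "A = {s \<in> space S. f s \<le> x}"
    have A: "A \<in> sets S" unfolding A_def by (rule sublevel_measurable[OF f])
    define W where "W j k = {\<omega> \<in> space ?P. \<forall>i<k. \<omega> (j + i) \<in> A}" for j k
    have W: "W j k \<in> sets ?P" for j k unfolding W_def by (rule window_measurable[OF lam A])
    have cdf_W: "max_cdf f lam k x = measure ?P (W 0 k)" for k
      by (simp only: max_cdf_def W_def A_def add_0)
    have stay_W: "(\<integral>s. stay A n s \<partial>law lam j) = measure ?P (W j n)" for j
      unfolding W_def by (rule measure_window[OF lam A, symmetric])
    have stay_p: "(\<integral>s. stay A n s \<partial>p) = max_cdf f p n x"
      unfolding max_cdf_def A_def[symmetric]
      by (rule measure_window[OF ps A, of n 0, unfolded add_0 law_0, symmetric])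
    have lower: "measure ?P (W 0 (n + J)) \<le> measure ?P (W j n)" if "j < J" for j
      by (rule P.finite_measure_mono[OF _ W]) (use that in \<open>auto simp: W_def\<close>)
    have upper: "measure ?P (W j n) \<le> measure ?P (W 0 n) + (1 - measure ?P (W 0 J))" if "j < J" for j
    proof -
      \<comment> \<open>Indices below \<open>J\<close> are covered by the initial segment, those from \<open>J\<close> on by the shifted window.\<close>
      have "W j n \<subseteq> W 0 n \<union> (space ?P - W 0 J)"
      proof
        fix \<omega> assume w: "\<omega> \<in> W j n"
        have "\<omega> i \<in> A" if "\<omega> \<in> W 0 J" "i < n" for i
        proof (cases "i < J")
          case True
          then show ?thesis using \<open>\<omega> \<in> W 0 J\<close> by (auto simp: W_def)
        next
          case False
          then have "i - j < n" "i = j + (i - j)" using \<open>i < n\<close> \<open>j < J\<close> by auto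
          then show ?thesis using w by (auto simp: W_def)
        qed
        then show "\<omega> \<in> W 0 n \<union> (space ?P - W 0 J)" using w by (auto simp: W_def)
      qed
      then have "measure ?P (W j n) \<le> measure ?P (W 0 n \<union> (space ?P - W 0 J))"
        using W by (intro P.finite_measure_mono) auto
      also have "\<dots> \<le> measure ?P (W 0 n) + measure ?P (space ?P - W 0 J)"
        using W by (intro measure_Un_le) auto
      finally show ?thesis using P.prob_compl[OF W] by simp
    qed
    define a where "a = (\<Sum>j<J. measure ?P (W j n)) / real J"
    have "real J * measure ?P (W 0 (n + J)) \<le> (\<Sum>j<J. measure ?P (W j n))"
      using sum_mono[of "{..<J}" "\<lambda>_. measure ?P (W 0 (n + J))" "\<lambda>j. measure ?P (W j n)"] lower by simp
    then have a1: "measure ?P (W 0 (n + J)) \<le> a" using J by (simp add: a_def field_simps)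
    have "(\<Sum>j<J. measure ?P (W j n)) \<le> real J * (measure ?P (W 0 n) + (1 - measure ?P (W 0 J)))"
      using sum_mono[of "{..<J}" "\<lambda>j. measure ?P (W j n)"
        "\<lambda>_. measure ?P (W 0 n) + (1 - measure ?P (W 0 J))"] upper by simp
    then have a2: "a \<le> measure ?P (W 0 n) + (1 - measure ?P (W 0 J))" using J by (simp add: a_def field_simps)
    have "\<bar>a - max_cdf f p n x\<bar> \<le> e"
      using tv[OF stay_unit[OF A, of n]] by (simp add: stay_W stay_p a_def)
    with a1 a2 show ?thesis unfolding cdf_W by linarith
  qed
  then show ?thesis by blast
qed

section \<open>The exceptional set of initial points\<close>

text \<open>
  For continuous \<open>G\<close>: the points where \<open>f\<close> is strictly below the right end point of \<open>G\<close>, which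
  may be infinite.
\<close>

definition essential_region :: "('a \<Rightarrow> real) \<Rightarrow> (real \<Rightarrow> real) \<Rightarrow> 'a set"
  where "essential_region f G = {s \<in> space S. G (f s) < 1}"

text \<open>
  The points from which the chain leaves the essential region with positive probability.
\<close>

definition exceptional_set :: "('a \<Rightarrow> real) \<Rightarrow> (real \<Rightarrow> real) \<Rightarrow> 'a set"
  where "exceptional_set f G = {s \<in> space S. \<exists>n. stay (essential_region f G) n s < 1}"

lemma essential_region_measurable:
  assumes "f \<in> borel_measurable S" "continuous_on UNIV G"
  shows "essential_region f G \<in> sets S"
proof -
  have [measurable]: "f \<in> borel_measurable S" "G \<in> borel_measurable borel"
    using assms by (auto intro: borel_measurable_continuous_onI)
  show ?thesis unfolding essential_region_def by measurable
qed

lemma exceptional_set_measurable: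
  assumes "f \<in> borel_measurable S" "continuous_on UNIV G"
  shows "exceptional_set f G \<in> sets S"
proof -
  have [measurable]: "stay (essential_region f G) n \<in> borel_measurable S" for n
    by (rule unit_functionsD(1)[OF stay_unit[OF essential_region_measurable[OF assms]]])
  show ?thesis unfolding exceptional_set_def by measurable
qed

text \<open>
  The probability of staying in the essential region is the integral of \<open>stay\<close>, which never exceeds
  \<open>1\<close>; the integral equals \<open>1\<close> only if the integrand does almost everywhere.
\<close>

lemma exceptional_set_null_iff:
  assumes f: "f \<in> borel_measurable S" and G: "continuous_on UNIV G"
    and lam: "lam \<in> space (prob_algebra S)"
  shows "emeasure lam (exceptional_set f G) = 0 \<longleftrightarrow>
    (\<forall>n. measure (chain_law S K lam)
      {\<omega> \<in> space (chain_law S K lam). \<forall>i<n. \<omega> i \<in> essential_region f G} = 1)"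
proof -
  let ?A = "essential_region f G"
  have sets: "sets lam = sets S" and "prob_space lam" using lam by (auto simp: space_prob_algebra)
  then interpret prob_space lam by simp
  have sp: "space lam = space S" by (rule sets_eq_imp_space_eq[OF sets])
  note A = essential_region_measurable[OF f G]
  note stay = stay_unit[OF A]
  have E: "exceptional_set f G \<in> sets lam" using exceptional_set_measurable[OF f G] by (simp add: sets)
  have "emeasure lam (exceptional_set f G) = 0 \<longleftrightarrow> (AE s in lam. s \<notin> exceptional_set f G)"
    using AE_iff_null_sets[OF E] E by (simp add: null_sets_def)
  also have "\<dots> \<longleftrightarrow> (AE s in lam. \<forall>n. 1 - stay ?A n s = 0)"
  proof (rule AE_cong)
    fix s assume "s \<in> space lam"
    then have s: "s \<in> space S" by (simp add: sp)
    have "stay ?A n s < 1 \<longleftrightarrow> 1 - stay ?A n s \<noteq> 0" for n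
      using unit_functionsD(3)[OF stay s, of n] by auto
    then show "s \<notin> exceptional_set f G \<longleftrightarrow> (\<forall>n. 1 - stay ?A n s = 0)"
      using s by (auto simp: exceptional_set_def)
  qed
  also have "\<dots> \<longleftrightarrow> (\<forall>n. AE s in lam. 1 - stay ?A n s = 0)" by (rule AE_all_countable)
  also have "\<dots> \<longleftrightarrow> (\<forall>n. (\<integral>s. 1 - stay ?A n s \<partial>lam) = 0)"
  proof (rule all_cong1)
    fix n
    show "(AE s in lam. 1 - stay ?A n s = 0) \<longleftrightarrow> (\<integral>s. 1 - stay ?A n s \<partial>lam) = 0"
      using integrable_unit_function[OF lam stay, of n] unit_functionsD(3)[OF stay, of _ n]
      by (subst integral_nonneg_eq_0_iff_AE) (auto simp: sp intro!: AE_I2)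
  qed
  also have "\<dots> \<longleftrightarrow> (\<forall>n. measure (chain_law S K lam)
      {\<omega> \<in> space (chain_law S K lam). \<forall>i<n. \<omega> i \<in> ?A} = 1)"
  proof (rule all_cong1)
    fix n
    have "measure (chain_law S K lam) {\<omega> \<in> space (chain_law S K lam). \<forall>i<n. \<omega> i \<in> ?A} = (\<integral>s. stay ?A n s \<partial>lam)"
      by (rule measure_window[OF lam A, of n 0, unfolded add_0 law_0])
    moreover have "(\<integral>s. 1 - stay ?A n s \<partial>lam) = 1 - (\<integral>s. stay ?A n s \<partial>lam)"
      using integrable_unit_function[OF lam stay, of n] by (simp add: prob_space)
    ultimately show "(\<integral>s. 1 - stay ?A n s \<partial>lam) = 0 \<longleftrightarrow>
      measure (chain_law S K lam) {\<omega> \<in> space (chain_law S K lam). \<forall>i<n. \<omega> i \<in> ?A} = 1" by simp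
  qed
  finally show ?thesis .
qed

text \<open>
  Staying below a level \<open>x\<close> with \<open>G x < 1\<close> means staying in the essential region.  Conversely the
  essential region is exhausted by the sublevel sets of \<open>f\<close> at levels \<open>x m\<close> with \<open>G (x m)\<close> increasing
  to \<open>1\<close>, so that continuity of measure provides a level for each \<open>J\<close> and \<open>e\<close>.
\<close>

lemma uniform_tail_iff_exceptional_set_null:
  assumes f: "f \<in> borel_measurable S" and G: "distribution_function G" "continuous_on UNIV G"
    and lam: "lam \<in> space (prob_algebra S)"
  shows "uniform_tail (max_cdf f lam) G \<longleftrightarrow> emeasure lam (exceptional_set f G) = 0"
proof -
  let ?P = "chain_law S K lam" and ?A = "essential_region f G"
  interpret P: prob_space ?P by (rule prob_space_chain_law[OF kernel lam])
  note Gb = distribution_function_bounds[OF G(1)]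
  define E where "E n = {\<omega> \<in> space ?P. \<forall>i<n. \<omega> i \<in> ?A}" for n
  have E: "E n \<in> sets ?P" for n
    unfolding E_def by (rule window_measurable[OF lam essential_region_measurable[OF f G(2)], of n 0, unfolded add_0])
  have "uniform_tail (max_cdf f lam) G \<longleftrightarrow> (\<forall>n. measure ?P (E n) = 1)"
  proof (intro iffI allI)
    fix n assume tail: "uniform_tail (max_cdf f lam) G"
    have "1 \<le> measure ?P (E n) + e" if "e > 0" for e
    proof -
      obtain x where x: "G x < 1" "1 - max_cdf f lam n x \<le> e"
        using tail \<open>e > 0\<close> unfolding uniform_tail_def by blast
      have "G (f s) < 1" if "f s \<le> x" for s using monoD[OF Gb(3) that] x(1) by linarith
      then have "max_cdf f lam n x \<le> measure ?P (E n)"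
        unfolding max_cdf_def by (intro P.finite_measure_mono E) (auto simp: E_def essential_region_def)
      with x(2) show ?thesis by linarith
    qed
    then have "1 \<le> measure ?P (E n)" by (rule field_le_epsilon)
    then show "measure ?P (E n) = 1" using P.prob_le_1[of "E n"] by linarith
  next
    assume one: "\<forall>n. measure ?P (E n) = 1"
    \<comment> \<open>The double successor keeps \<open>t m\<close> positive, so that it is a value of \<open>G\<close>.\<close>
    define t :: "nat \<Rightarrow> real" where "t m = 1 - inverse (real (Suc (Suc m)))" for m
    have t: "0 < t m" "t m < 1" for m
      unfolding t_def by (auto simp: inverse_less_1_iff)
    have t_mono: "t m < t k" if "m < k" for m k
      using that unfolding t_def by simp
    have "(\<lambda>m. 1 - inverse (real (Suc (Suc m)))) \<longlonglongrightarrow> 1 - 0"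
      by (intro tendsto_diff tendsto_const LIMSEQ_Suc[OF LIMSEQ_inverse_real_of_nat])
    then have t_lim: "t \<longlonglongrightarrow> 1" by (simp add: t_def[abs_def])
    have "\<exists>x. G x = t m" for m using continuous_distribution_function_attains[OF G t] by blast
    then obtain x where x: "\<And>m. G (x m) = t m" by metis
    have below: "a \<le> x m" if "G a < t m" for a m
    proof (rule ccontr)
      assume "\<not> a \<le> x m"
      then have "G (x m) \<le> G a" by (intro monoD[OF Gb(3)]) auto
      with that x show False by auto
    qed
    have x_mono: "x m \<le> x k" if "m \<le> k" for m k
      using that below[of "x m" k] t_mono[of m k] x by (cases "m = k") auto
    show "uniform_tail (max_cdf f lam) G"
      unfolding uniform_tail_def
    proof (intro allI impI)
      fix J :: nat and e :: real assume e: "e > 0"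
      define B where "B m = {\<omega> \<in> space ?P. \<forall>i<J. \<omega> i \<in> {s \<in> space S. f s \<le> x m}}" for m
      have B: "B m \<in> sets ?P" for m unfolding B_def by (rule max_cdf_measurable[OF f lam])
      have lim: "(\<lambda>m. measure ?P (B m)) \<longlonglongrightarrow> measure ?P (\<Union>m. B m)"
      proof (rule P.finite_Lim_measure_incseq)
        show "range B \<subseteq> sets ?P" using B by blast
        show "incseq B"
        proof (rule incseq_SucI)
          fix m
          have "x m \<le> x (Suc m)" by (rule x_mono) simp
          then show "B m \<subseteq> B (Suc m)" by (auto simp: B_def intro: order_trans)
        qed
      qed
      have "E J \<subseteq> (\<Union>m. B m)"
      proof
        fix \<omega> assume w: "\<omega> \<in> E J"
        have "eventually (\<lambda>m. G (f (\<omega> i)) < t m) sequentially" if "i \<in> {..<J}" for i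
          using w that by (intro order_tendstoD(1)[OF t_lim]) (auto simp: E_def essential_region_def)
        then have "eventually (\<lambda>m. \<forall>i\<in>{..<J}. G (f (\<omega> i)) < t m) sequentially"
          by (intro eventually_ball_finite) auto
        then obtain m where m: "\<And>i. i < J \<Longrightarrow> G (f (\<omega> i)) < t m" by (auto simp: eventually_sequentially)
        have "\<omega> \<in> B m" using w below[OF m] by (auto simp: B_def E_def essential_region_def)
        then show "\<omega> \<in> (\<Union>m. B m)" by blast
      qed
      then have "measure ?P (E J) \<le> measure ?P (\<Union>m. B m)"
        using B by (intro P.finite_measure_mono) auto
      then have "1 - e < measure ?P (\<Union>m. B m)" using one e by simp
      then obtain m where "1 - e < measure ?P (B m)"
        using order_tendstoD(1)[OF lim] by (auto simp: eventually_sequentially)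
      then have "1 - max_cdf f lam J (x m) \<le> e" by (simp add: max_cdf_def B_def)
      then show "\<exists>x. G x < 1 \<and> 1 - max_cdf f lam J x \<le> e"
        using x t(2) by (intro exI[of _ "x m"]) auto
    qed
  qed
  then show ?thesis unfolding E_def by (simp add: exceptional_set_null_iff[OF f G(2) lam])
qed

lemma phantom_transfer:
  assumes harris: "harris_recurrent S K" and p: "stationary_distribution S K p"
    and f: "f \<in> borel_measurable S" and lam: "lam \<in> space (prob_algebra S)"
    and G: "distribution_function G" and tail: "uniform_tail (max_cdf f lam) G"
  shows "uniformly_phantom (max_cdf f lam) G \<longleftrightarrow> uniformly_phantom (max_cdf f p) G"
proof -
  have ps: "p \<in> space (prob_algebra S)" using p by (simp add: stationary_distribution_def)
  show ?thesis
    by (rule sandwich_phantom_iff[OF G tail])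
       (auto intro: max_cdf_bounds[OF f lam] max_cdf_bounds[OF f ps] max_cdf_sandwich[OF harris p f lam])
qed

end

theorem theorem1:
  fixes S :: "'a measure" and K :: "'a \<Rightarrow> 'a measure" and p :: "'a measure"
    and f :: "'a \<Rightarrow> real" and X :: "nat \<Rightarrow> (nat \<Rightarrow> 'a) \<Rightarrow> real"
  assumes kernel: "K \<in> S \<rightarrow>\<^sub>M prob_algebra S"
    and harris: "positive_harris S K"
    and stationary: "stationary_distribution S K p"
    and aperiodic: "aperiodic S K p"
    and f: "f \<in> borel_measurable S"
    and X: "\<And>n \<omega>. X n \<omega> = f (\<omega> n)"
  shows "(\<forall>lam\<in>space (prob_algebra S). \<forall>G.
            continuous_phantom (chain_law S K lam) X G \<longrightarrow>
            continuous_phantom (chain_law S K p) X G)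
       \<and> (\<forall>G. continuous_phantom (chain_law S K p) X G \<longrightarrow>
            (\<exists>S\<^sub>0\<in>sets S. emeasure p S\<^sub>0 = 0 \<and>
              (\<forall>lam\<in>space (prob_algebra S). emeasure lam S\<^sub>0 = 0 \<longrightarrow>
                continuous_phantom (chain_law S K lam) X G)))"
proof -
  interpret markov_kernel S K by unfold_locales (rule kernel)
  have hr: "harris_recurrent S K" using harris by (simp add: positive_harris_def)
  have ps: "p \<in> space (prob_algebra S)" using stationary by (simp add: stationary_distribution_def)
  have phantom: "continuous_phantom (chain_law S K lam) X G \<longleftrightarrow>
      distribution_function G \<and> continuous_on UNIV G \<and> uniformly_phantom (max_cdf f lam) G"
    if "lam \<in> space (prob_algebra S)" for lam G
    by (rule continuous_phantom_iff[OF f that]) (rule X)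
  have tail: "uniform_tail (max_cdf f lam) G"
    if "lam \<in> space (prob_algebra S)" "distribution_function G" "continuous_on UNIV G"
      "uniformly_phantom (max_cdf f lam) G" for lam G
    using phantom_imp_tail[OF that(4,2,3)] max_cdf_bounds(4)[OF f that(1)] by blast
  show ?thesis
  proof (intro conjI ballI allI impI)
    fix lam G assume lam: "lam \<in> space (prob_algebra S)"
      and "continuous_phantom (chain_law S K lam) X G"
    then have G: "distribution_function G" "continuous_on UNIV G"
      and ph: "uniformly_phantom (max_cdf f lam) G" by (auto simp: phantom[OF lam])
    show "continuous_phantom (chain_law S K p) X G"
      using G ph phantom_transfer[OF hr stationary f lam G(1) tail[OF lam G ph]]
      by (simp add: phantom[OF ps])
  next
    fix G assume "continuous_phantom (chain_law S K p) X G"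
    then have G: "distribution_function G" "continuous_on UNIV G"
      and ph: "uniformly_phantom (max_cdf f p) G" by (auto simp: phantom[OF ps])
    note null_iff = uniform_tail_iff_exceptional_set_null[OF f G]
    show "\<exists>S\<^sub>0\<in>sets S. emeasure p S\<^sub>0 = 0 \<and>
        (\<forall>lam\<in>space (prob_algebra S). emeasure lam S\<^sub>0 = 0 \<longrightarrow>
          continuous_phantom (chain_law S K lam) X G)"
    proof (intro bexI conjI ballI impI)
      show "exceptional_set f G \<in> sets S" by (rule exceptional_set_measurable[OF f G(2)])
      show "emeasure p (exceptional_set f G) = 0"
        using tail[OF ps G ph] by (simp add: null_iff[OF ps])
      fix lam assume lam: "lam \<in> space (prob_algebra S)" and "emeasure lam (exceptional_set f G) = 0"
      then have "uniform_tail (max_cdf f lam) G" by (simp add: null_iff[OF lam])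
      then show "continuous_phantom (chain_law S K lam) X G"
        using G ph phantom_transfer[OF hr stationary f lam G(1)] by (simp add: phantom[OF lam])
    qed
  qed
qed

end
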